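(* Let $(E,\mathcal P)$ be a random locally convex module over $K$ with base $(\Omega,\mathcal F,P)$ such that $E$ has the countable concatenation property, and let $G\subset E$. Write $\bar G_{\varepsilon,\lambda}$ (or $[G]^-_{\varepsilon,\lambda}$) and $\bar G_c$ (or $[G]^-_c$) for the closures of $G$ in the $(\varepsilon,\lambda)$-topology and in the locally $L^0$-convex topology induced by $\mathcal P$, respectively. Then: (1) If $G$ has the countable concatenation property, then $\bar G_c=\bar G_{\varepsilon,\lambda}$ and this set has the countable concatenation property. (2) If $G$ is $L^0$-convex, then $\bar G_{\varepsilon,\lambda}=[H_{cc}(G)]^-_{\varepsilon,\lambda}=[H_{cc}(G)]^-_c$, and this set has the countable concatenation property, where $H_{cc}(G)$ is the countable concatenation hull of $G$ in $E$.
   Context: $(\Omega,\mathcal F,P)$ is a probability space and $K=\mathbb R$ or $\mathbb C$. $L^0(\mathcal F,K)$ is the algebra of (a.s.-equality) equivalence classes of $K$-valued $\mathcal F$-measurable random variables, $L^0(\mathcal F)=L^0(\mathcal F,\mathbb R)$ with the a.s. order, $L^0_+(\mathcal F)=\{\xi\in L^0(\mathcal F):\xi\ge0\}$, $L^0_{++}(\mathcal F)=\{\xi\in L^0(\mathcal F):\xi>0\text{ a.s. on }\Omega\}$. $\tilde I_A$ is the class of the indicator of $A\in\mathcal F$. An $L^0$-seminorm on an $L^0(\mathcal F,K)$-module $E$ is a map $\|\cdot\|:E\to L^0_+(\mathcal F)$ with $\|\xi x\|=|\xi|\|x\|$ and $\|x+y\|\le\|x\|+\|y\|$ for $\xi\in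 L^0(\mathcal F,K)$, $x,y\in E$. A random locally convex module over $K$ with base $(\Omega,\mathcal F,P)$ is a pair $(E,\mathcal P)$ with $E$ an $L^0(\mathcal F,K)$-module and $\mathcal P$ a family of $L^0$-seminorms on $E$ such that $\bigvee\{\|x\|:\|\cdot\|\in\mathcal P\}=0$ iff $x=\theta$ (the null element). For a finite subset $\mathcal Q\subset\mathcal P$ put $\|x\|_{\mathcal Q}=\bigvee\{\|x\|:\|\cdot\|\in\mathcal Q\}$. $(\varepsilon,\lambda)$-topology: the linear topology with local base at $\theta$ consisting of the sets $\{x\in E: P\{\|x\|_{\mathcal Q}<\varepsilon\}>1-\lambda\}$, $\mathcal Q\subset\mathcal P$ finite, $\varepsilon>0$, $0<\lambda<1$ real numbers. Locally $L^0$-convex topology $\mathcal T_c$: the topology with local base at $\theta$ consisting of the sets $\{x\in E:\|x\|_{\mathcal Q}\le\varepsilon\}$, $\mathcal Q\subset\mathcal P$ finite, $\varepsilon\in L^0_{++}(\mathcal F)$. A set $G\subset E$ is $L^0$-convex if $\xi x+(1-\xi)y\in G$ for all $x,y\in G$ and $\xi\in L^0_+(\mathcal F)$ with $0\le\xi\le1$. For a countable partition $\{A_n\}$ of $\Omega$ into sets of $\mathcal F$ and a sequence $\{x_n\}$ in $E$, $\sum_{n}\tilde I_{A_n}x_n$ denotes the (unique, if it exists) $x\in E$ with $\tilde I_{A_n}x=\tilde I_{A_n}x_n$ for all $n$. A set $G\subset E$ has the countable concatenation property if for every sequence $\{x_n\}$ in $G$ and every countable partition $\{A_n\}$ of $\Omega$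 into sets of $\mathcal F$, $\sum_n\tilde I_{A_n}x_n$ exists in $E$ and belongs to $G$. When $E$ has this property, $H_{cc}(G)=\{\sum_n\tilde I_{A_n}x_n:\{x_n\}\text{ a sequence in }G,\ \{A_n\}\text{ a countable partition of }\Omega\text{ into sets of }\mathcal F\}$. *)

theory Defs
  imports "HOL-Probability.Probability" "HOL-Algebra.Module" "HOL-Algebra.AbelCoset" "HOL-Algebra.Lattice"
begin

(* closure_of denotes the closure in an abstract topology; HOL-Algebra's operator of the
   same name for setoids is not used. *)
no_notation eq_closure_of (\<open>closure'_of\<index>\<close>)

section \<open>The algebra of equivalence classes of random variables\<close>

text \<open>
  The scalar field ranges over types of sort \<open>{real_normed_field, euclidean_space}\<close>. The types
  \<open>real\<close> and \<open>complex\<close> have this sort, and up to isometric isomorphism they are the only ones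
  (a finite-dimensional real field is the real or the complex numbers, and the norm is
  multiplicative).
\<close>

definition ae_equal :: "'w measure \<Rightarrow> (('w \<Rightarrow> 'k::topological_space) \<times> ('w \<Rightarrow> 'k)) set" where
  "ae_equal M = {(f, g). f \<in> borel_measurable M \<and> g \<in> borel_measurable M \<and> (AE w in M. f w = g w)}"

definition L0 :: "'w measure \<Rightarrow> ('w \<Rightarrow> 'k::topological_space) set set" where
  "L0 M = borel_measurable M // ae_equal M"

definition L0_class :: "'w measure \<Rightarrow> ('w \<Rightarrow> 'k::topological_space) \<Rightarrow> ('w \<Rightarrow> 'k) set" where
  "L0_class M f = ae_equal M `` {f}"

text \<open>A representative of a class. It is used only in ways that depend on the class alone.\<close>

definition L0_rep :: "('w \<Rightarrow> 'k) set \<Rightarrow> 'w \<Rightarrow> 'k" where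
  "L0_rep X = (SOME f. f \<in> X)"

definition L0_ring :: "'w measure \<Rightarrow> ('w \<Rightarrow> 'k::{real_normed_field, euclidean_space}) set ring" where
  "L0_ring M =
    \<lparr> carrier = L0 M,
      mult = (\<lambda>X Y. L0_class M (\<lambda>w. L0_rep X w * L0_rep Y w)),
      one = L0_class M (\<lambda>_. 1),
      zero = L0_class M (\<lambda>_. 0),
      add = (\<lambda>X Y. L0_class M (\<lambda>w. L0_rep X w + L0_rep Y w)) \<rparr>"

definition L0_order :: "'w measure \<Rightarrow> ('w \<Rightarrow> real) set gorder" where
  "L0_order M =
    \<lparr> carrier = L0 M, eq = (=), le = (\<lambda>X Y. AE w in M. L0_rep X w \<le> L0_rep Y w) \<rparr>"

definition L0_nonneg :: "'w measure \<Rightarrow> ('w \<Rightarrow> real) set set" where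
  "L0_nonneg M = {X \<in> L0 M. \<zero>\<^bsub>L0_ring M\<^esub> \<sqsubseteq>\<^bsub>L0_order M\<^esub> X}"

definition L0_pos :: "'w measure \<Rightarrow> ('w \<Rightarrow> real) set set" where
  "L0_pos M = {X \<in> L0 M. AE w in M. 0 < L0_rep X w}"

definition L0_abs :: "'w measure \<Rightarrow> ('w \<Rightarrow> 'k::real_normed_vector) set \<Rightarrow> ('w \<Rightarrow> real) set" where
  "L0_abs M X = L0_class M (\<lambda>w. norm (L0_rep X w))"

definition L0_of_real :: "'w measure \<Rightarrow> ('w \<Rightarrow> real) set
    \<Rightarrow> ('w \<Rightarrow> 'k::{real_normed_field, euclidean_space}) set" where
  "L0_of_real M X = L0_class M (\<lambda>w. of_real (L0_rep X w))"

definition L0_ind :: "'w measure \<Rightarrow> 'w set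
    \<Rightarrow> ('w \<Rightarrow> 'k::{real_normed_field, euclidean_space}) set" where
  "L0_ind M A = L0_class M (indicator A)"


section \<open>Random locally convex modules\<close>

definition L0_seminorm :: "'w measure
    \<Rightarrow> (('w \<Rightarrow> 'k::{real_normed_field, euclidean_space}) set, 'e) module
    \<Rightarrow> ('e \<Rightarrow> ('w \<Rightarrow> real) set) \<Rightarrow> bool" where
  "L0_seminorm M E p \<longleftrightarrow>
    (\<forall>x\<in>carrier E. p x \<in> L0_nonneg M) \<and>
    (\<forall>\<xi>\<in>L0 M. \<forall>x\<in>carrier E. p (\<xi> \<odot>\<^bsub>E\<^esub> x) = L0_abs M \<xi> \<otimes>\<^bsub>L0_ring M\<^esub> p x) \<and>
    (\<forall>x\<in>carrier E. \<forall>y\<in>carrier E.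
      p (x \<oplus>\<^bsub>E\<^esub> y) \<sqsubseteq>\<^bsub>L0_order M\<^esub> (p x \<oplus>\<^bsub>L0_ring M\<^esub> p y))"

text \<open>
  The supremum of a possibly infinite family need not exist in \<open>L0 M\<close>, so the equation
  \<open>\<Or>{p x | p \<in> N} = 0\<close> is spelled out as: the zero class is the least upper bound. The family
  is then automatically nonempty, because \<open>L0 M\<close> has no least element.
\<close>

definition random_lc_module :: "'w measure
    \<Rightarrow> (('w \<Rightarrow> 'k::{real_normed_field, euclidean_space}) set, 'e) module
    \<Rightarrow> ('e \<Rightarrow> ('w \<Rightarrow> real) set) set \<Rightarrow> bool" where
  "random_lc_module M E N \<longleftrightarrow>
    prob_space M \<and> module (L0_ring M) E \<and> (\<forall>p\<in>N. L0_seminorm M E p) \<and>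
    (\<forall>x\<in>carrier E.
      least (L0_order M) \<zero>\<^bsub>L0_ring M\<^esub> (Upper (L0_order M) ((\<lambda>p. p x) ` N)) \<longleftrightarrow> x = \<zero>\<^bsub>E\<^esub>)"

definition fin_sup_seminorm :: "'w measure \<Rightarrow> ('e \<Rightarrow> ('w \<Rightarrow> real) set) set \<Rightarrow> 'e
    \<Rightarrow> ('w \<Rightarrow> real) set" where
  "fin_sup_seminorm M Q x = \<Squnion>\<^bsub>L0_order M\<^esub> ((\<lambda>p. p x) ` Q)"


section \<open>The two topologies\<close>

text \<open>The translation-invariant topology on an abelian group with a given local base at zero.\<close>

definition local_base_topology :: "('a, 'e) module \<Rightarrow> 'e set set \<Rightarrow> 'e topology" where
  "local_base_topology E \<U> =
    topology (\<lambda>U. U \<subseteq> carrier E \<and> (\<forall>x\<in>U. \<exists>B\<in>\<U>. x <+\<^bsub>E\<^esub> B \<subseteq> U))"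

lemma openin_local_base_topology:
  assumes directed: "\<And>B C. B \<in> \<U> \<Longrightarrow> C \<in> \<U> \<Longrightarrow> \<exists>D\<in>\<U>. D \<subseteq> B \<inter> C"
  shows "openin (local_base_topology E \<U>) U \<longleftrightarrow>
    U \<subseteq> carrier E \<and> (\<forall>x\<in>U. \<exists>B\<in>\<U>. x <+\<^bsub>E\<^esub> B \<subseteq> U)"
proof -
  let ?P = "\<lambda>U. U \<subseteq> carrier E \<and> (\<forall>x\<in>U. \<exists>B\<in>\<U>. x <+\<^bsub>E\<^esub> B \<subseteq> U)"
  have mono: "x <+\<^bsub>E\<^esub> D \<subseteq> x <+\<^bsub>E\<^esub> B" if "D \<subseteq> B" for x D B
    using that by (auto simp: a_l_coset_def l_coset_def)
  have Int: "?P (S \<inter> T)" if S: "?P S" and T: "?P T" for S T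
  proof (intro conjI ballI)
    show "S \<inter> T \<subseteq> carrier E" using S by (simp add: le_infI1)
    fix x assume x: "x \<in> S \<inter> T"
    from x S obtain B where B: "B \<in> \<U>" "x <+\<^bsub>E\<^esub> B \<subseteq> S" by (meson IntD1)
    from x T obtain C where C: "C \<in> \<U>" "x <+\<^bsub>E\<^esub> C \<subseteq> T" by (meson IntD2)
    obtain D where D: "D \<in> \<U>" "D \<subseteq> B \<inter> C" using directed[OF B(1) C(1)] by (elim bexE)
    have "x <+\<^bsub>E\<^esub> D \<subseteq> S \<inter> T"
      using subset_trans[OF mono B(2), of D] subset_trans[OF mono C(2), of D] D(2) by simp
    with D(1) show "\<exists>B\<in>\<U>. x <+\<^bsub>E\<^esub> B \<subseteq> S \<inter> T" by (rule bexI[rotated])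
  qed
  have Un: "?P (\<Union>\<K>)" if K: "\<forall>K\<in>\<K>. ?P K" for \<K>
  proof (intro conjI ballI)
    show "\<Union>\<K> \<subseteq> carrier E" using K by (simp add: Sup_le_iff)
    fix x assume "x \<in> \<Union>\<K>"
    then obtain K where x: "K \<in> \<K>" "x \<in> K" by (elim UnionE)
    with K obtain B where "B \<in> \<U>" "x <+\<^bsub>E\<^esub> B \<subseteq> K" by meson
    with Union_upper[OF x(1)] show "\<exists>B\<in>\<U>. x <+\<^bsub>E\<^esub> B \<subseteq> \<Union>\<K>"
      by (intro bexI[of _ B]) (rule subset_trans)
  qed
  have "istopology ?P"
    unfolding istopology_def by (rule conjI; intro allI impI; (erule (1) Int | erule Un))
  from topology_inverse'[OF this] show ?thesis
    unfolding local_base_topology_def by (rule fun_cong)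
qed

text \<open>
  Only nonempty finite subfamilies \<open>Q\<close> are used, since the empty supremum does not exist in
  \<open>L0 M\<close>. As the family of seminorms is nonempty, this does not affect the topologies.
\<close>

definition epsilon_lambda_base :: "'w measure \<Rightarrow> ('a, 'e) module
    \<Rightarrow> ('e \<Rightarrow> ('w \<Rightarrow> real) set) set \<Rightarrow> 'e set set" where
  "epsilon_lambda_base M E N =
    {{x \<in> carrier E. measure M {w \<in> space M. L0_rep (fin_sup_seminorm M Q x) w < e} > 1 - l}
      | Q e l. Q \<subseteq> N \<and> finite Q \<and> Q \<noteq> {} \<and> 0 < e \<and> 0 < l \<and> l < 1}"

definition locally_L0_convex_base :: "'w measure \<Rightarrow> ('a, 'e) module
    \<Rightarrow> ('e \<Rightarrow> ('w \<Rightarrow> real) set) set \<Rightarrow> 'e set set" where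
  "locally_L0_convex_base M E N =
    {{x \<in> carrier E. fin_sup_seminorm M Q x \<sqsubseteq>\<^bsub>L0_order M\<^esub> e}
      | Q e. Q \<subseteq> N \<and> finite Q \<and> Q \<noteq> {} \<and> e \<in> L0_pos M}"

definition epsilon_lambda_topology :: "'w measure \<Rightarrow> ('a, 'e) module
    \<Rightarrow> ('e \<Rightarrow> ('w \<Rightarrow> real) set) set \<Rightarrow> 'e topology" where
  "epsilon_lambda_topology M E N = local_base_topology E (epsilon_lambda_base M E N)"

definition locally_L0_convex_topology :: "'w measure \<Rightarrow> ('a, 'e) module
    \<Rightarrow> ('e \<Rightarrow> ('w \<Rightarrow> real) set) set \<Rightarrow> 'e topology" where
  "locally_L0_convex_topology M E N = local_base_topology E (locally_L0_convex_base M E N)"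


section \<open>Convexity and countable concatenation\<close>

definition L0_convex :: "'w measure
    \<Rightarrow> (('w \<Rightarrow> 'k::{real_normed_field, euclidean_space}) set, 'e) module \<Rightarrow> 'e set \<Rightarrow> bool" where
  "L0_convex M E G \<longleftrightarrow>
    (\<forall>x\<in>G. \<forall>y\<in>G. \<forall>\<xi>\<in>L0_nonneg M. \<xi> \<sqsubseteq>\<^bsub>L0_order M\<^esub> \<one>\<^bsub>L0_ring M\<^esub> \<longrightarrow>
      L0_of_real M \<xi> \<odot>\<^bsub>E\<^esub> x \<oplus>\<^bsub>E\<^esub> (\<one>\<^bsub>L0_ring M\<^esub> \<ominus>\<^bsub>L0_ring M\<^esub> L0_of_real M \<xi>) \<odot>\<^bsub>E\<^esub> y \<in> G)"

text \<open>Finite partitions are included by padding with empty sets.\<close>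

definition countable_partition :: "'w measure \<Rightarrow> (nat \<Rightarrow> 'w set) \<Rightarrow> bool" where
  "countable_partition M A \<longleftrightarrow>
    range A \<subseteq> sets M \<and> disjoint_family A \<and> (\<Union>n. A n) = space M"

text \<open>
  \<open>is_concatenation M E A X x\<close> says that \<open>x\<close> is the concatenation of the sequence \<open>X\<close> along
  the partition \<open>A\<close>. In a random locally convex module there is at most one such \<open>x\<close>.
\<close>

definition is_concatenation :: "'w measure
    \<Rightarrow> (('w \<Rightarrow> 'k::{real_normed_field, euclidean_space}) set, 'e) module
    \<Rightarrow> (nat \<Rightarrow> 'w set) \<Rightarrow> (nat \<Rightarrow> 'e) \<Rightarrow> 'e \<Rightarrow> bool" where
  "is_concatenation M E A X x \<longleftrightarrow>
    x \<in> carrier E \<and> (\<forall>n. L0_ind M (A n) \<odot>\<^bsub>E\<^esub> x = L0_ind M (A n) \<odot>\<^bsub>E\<^esub> X n)"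

definition countable_concatenation_property :: "'w measure
    \<Rightarrow> (('w \<Rightarrow> 'k::{real_normed_field, euclidean_space}) set, 'e) module \<Rightarrow> 'e set \<Rightarrow> bool" where
  "countable_concatenation_property M E G \<longleftrightarrow>
    (\<forall>X A. range X \<subseteq> G \<and> countable_partition M A \<longrightarrow> (\<exists>x\<in>G. is_concatenation M E A X x))"

definition countable_concatenation_hull :: "'w measure
    \<Rightarrow> (('w \<Rightarrow> 'k::{real_normed_field, euclidean_space}) set, 'e) module \<Rightarrow> 'e set \<Rightarrow> 'e set" where
  "countable_concatenation_hull M E G =
    {x. \<exists>X A. range X \<subseteq> G \<and> countable_partition M A \<and> is_concatenation M E A X x}"

end

theory Submission
  imports Defs
begin

text \<open>
  If an \<open>(\<epsilon>, \<lambda>)\<close>-adherent point \<open>x\<close> of \<open>G\<close> and a random tolerance \<open>f > 0\<close> are given, then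
  for every \<open>n\<close> some \<open>Y n \<in> G\<close> is within \<open>f\<close> of \<open>x\<close> with probability close to \<open>1\<close>. The events
  where this happens cover the space up to a null set, so that concatenating the \<open>Y n\<close> along a
  disjoint refinement gives an element of \<open>G\<close> within \<open>f\<close> of \<open>x\<close> almost surely. For
  \<open>L\<^sup>0\<close>-convex \<open>G\<close>, finite concatenations stay in \<open>G\<close> and approximate countable ones in
  probability, which reduces the second part to the first one applied to the hull.
\<close>


section \<open>Representatives\<close>

lemma equiv_ae_equal: "equiv (borel_measurable M) (ae_equal M)"
proof (rule equivI)
  show "ae_equal M \<subseteq> borel_measurable M \<times> borel_measurable M"
    by (auto simp: ae_equal_def)
  show "refl_on (borel_measurable M) (ae_equal M)"
    by (auto simp: ae_equal_def refl_on_def)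
  show "sym (ae_equal M)"
    by (auto simp: ae_equal_def sym_def elim: eventually_mono)
  show "trans (ae_equal M)"
    unfolding ae_equal_def trans_def by auto
qed

lemma L0_class_in_L0: "f \<in> borel_measurable M \<Longrightarrow> L0_class M f \<in> L0 M"
  by (auto simp: L0_def L0_class_def intro: quotientI)

lemma L0_class_cong:
  assumes "f \<in> borel_measurable M" "g \<in> borel_measurable M" "AE w in M. f w = g w"
  shows "L0_class M f = L0_class M g"
  unfolding L0_class_def
  by (rule equiv_class_eq[OF equiv_ae_equal]) (use assms in \<open>auto simp: ae_equal_def\<close>)

text \<open>The class is nonempty and all its members are measurable and agree almost everywhere, so
  the member picked by \<open>SOME\<close> inherits both properties. Every later computation with
  representatives rests on these two facts and therefore holds only outside a null set.\<close>

lemma L0_rep_class: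
  assumes "f \<in> borel_measurable M"
  shows "L0_rep (L0_class M f) \<in> borel_measurable M"
    and "AE w in M. L0_rep (L0_class M f) w = f w"
proof -
  have "f \<in> L0_class M f"
    unfolding L0_class_def by (rule equiv_class_self[OF equiv_ae_equal assms])
  then have "L0_rep (L0_class M f) \<in> L0_class M f"
    unfolding L0_rep_def by (rule someI[of "\<lambda>g. g \<in> L0_class M f"])
  then have "(f, L0_rep (L0_class M f)) \<in> ae_equal M"
    by (simp add: L0_class_def)
  then show "L0_rep (L0_class M f) \<in> borel_measurable M"
    and "AE w in M. L0_rep (L0_class M f) w = f w"
    by (auto simp: ae_equal_def elim: eventually_mono)
qed

lemma L0_cases:
  assumes "X \<in> L0 M"
  obtains f where "f \<in> borel_measurable M" "X = L0_class M f"
  using assms unfolding L0_def L0_class_def by (elim quotientE)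

lemma L0_rep_measurable: "X \<in> L0 M \<Longrightarrow> L0_rep X \<in> borel_measurable M"
  by (metis L0_cases L0_rep_class(1))

lemma L0_class_rep:
  assumes "X \<in> L0 M"
  shows "L0_class M (L0_rep X) = X"
proof -
  obtain f where f: "f \<in> borel_measurable M" "X = L0_class M f"
    using L0_cases[OF assms] .
  show ?thesis
    unfolding f(2) by (rule L0_class_cong[OF L0_rep_class(1) f(1) L0_rep_class(2)]) (rule f(1))+
qed

lemma L0_eqI:
  assumes "X \<in> L0 M" "Y \<in> L0 M" "AE w in M. L0_rep X w = L0_rep Y w"
  shows "X = Y"
  using L0_class_cong[OF L0_rep_measurable[OF assms(1)] L0_rep_measurable[OF assms(2)] assms(3)]
  by (simp add: L0_class_rep assms)

section \<open>Indicator classes as ring elements and as convex coefficients\<close>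

lemma L0_ind_mult:
  fixes M :: "'w measure"
  assumes "A \<in> sets M" "B \<in> sets M"
  shows "L0_ind M A \<otimes>\<^bsub>L0_ring M\<^esub> L0_ind M B
    = (L0_ind M (A \<inter> B) :: ('w \<Rightarrow> 'k::{real_normed_field, euclidean_space}) set)"
proof -
  let ?i = "\<lambda>A. indicator A :: 'w \<Rightarrow> 'k"
  have m: "?i A \<in> borel_measurable M" "?i B \<in> borel_measurable M" "?i (A \<inter> B) \<in> borel_measurable M"
    using assms by auto
  have "AE w in M. L0_rep (L0_class M (?i A)) w * L0_rep (L0_class M (?i B)) w = ?i (A \<inter> B) w"
    using L0_rep_class(2)[OF m(1)] L0_rep_class(2)[OF m(2)]
    by eventually_elim (simp add: indicator_inter_arith)
  then show ?thesis
    unfolding L0_ring_def L0_ind_def monoid.simps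
    by (intro L0_class_cong borel_measurable_times L0_rep_class(1) m)
qed

lemma L0_ind_empty: "L0_ind M {} = \<zero>\<^bsub>L0_ring M\<^esub>"
  by (simp add: L0_ind_def L0_ring_def indicator_def[abs_def])

lemma L0_ind_in_carrier: "A \<in> sets M \<Longrightarrow> L0_ind M A \<in> carrier (L0_ring M)"
  by (simp add: L0_ind_def L0_ring_def L0_class_in_L0)

text \<open>\<open>L0_convex\<close> takes real coefficients and embeds them by
  \<open>L0_of_real\<close>. Together with the bounds in \<open>L0_ind_nonneg_le_one\<close>, this
  allows indicator classes to serve as coefficients of convex combinations over either scalar
  field.\<close>

lemma L0_of_real_ind:
  fixes M :: "'w measure"
  assumes "A \<in> sets M"
  shows "L0_of_real M (L0_ind M A)
    = (L0_ind M A :: ('w \<Rightarrow> 'k::{real_normed_field, euclidean_space}) set)"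
proof -
  have m: "(indicator A :: 'w \<Rightarrow> real) \<in> borel_measurable M" using assms by auto
  have "AE w in M. (of_real (L0_rep (L0_class M (indicator A)) w) :: 'k) = indicator A w"
    using L0_rep_class(2)[OF m] by eventually_elim (simp add: indicator_def)
  moreover have "(\<lambda>w. of_real (L0_rep (L0_class M (indicator A)) w) :: 'k) \<in> borel_measurable M"
    using L0_rep_class(1)[OF m] by measurable
  ultimately show ?thesis
    unfolding L0_of_real_def L0_ind_def using assms by (intro L0_class_cong) auto
qed

lemma L0_ind_nonneg_le_one:
  fixes M :: "'w measure"
  assumes "A \<in> sets M"
  shows "L0_ind M A \<in> L0_nonneg M" "L0_ind M A \<sqsubseteq>\<^bsub>L0_order M\<^esub> \<one>\<^bsub>L0_ring M\<^esub>"
proof -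
  have m: "(indicator A :: 'w \<Rightarrow> real) \<in> borel_measurable M"
    "(\<lambda>_. 0::real) \<in> borel_measurable M" "(\<lambda>_. 1::real) \<in> borel_measurable M"
    using assms by auto
  note r = m[THEN L0_rep_class(2)]
  have "AE w in M. L0_rep (L0_class M (\<lambda>_. 0::real)) w \<le> L0_rep (L0_class M (indicator A)) w"
    using r(1,2) by eventually_elim simp
  moreover have "AE w in M. L0_rep (L0_class M (indicator A)) w \<le> L0_rep (L0_class M (\<lambda>_. 1::real)) w"
    using r(1,3) by eventually_elim simp
  ultimately show "L0_ind M A \<in> L0_nonneg M" "L0_ind M A \<sqsubseteq>\<^bsub>L0_order M\<^esub> \<one>\<^bsub>L0_ring M\<^esub>"
    by (simp_all add: L0_nonneg_def L0_order_def L0_ring_def L0_ind_def L0_class_in_L0[OF m(1)])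
qed

text \<open>The pointwise maximum of finitely many representatives is measurable. Its class is a
  least upper bound, because the finitely many null sets on which the individual comparisons fail
  have a null union.\<close>

lemma L0_rep_finite_sup:
  fixes F :: "('w \<Rightarrow> real) set set"
  assumes "finite F" "F \<noteq> {}" "F \<subseteq> L0 M"
  shows "\<Squnion>\<^bsub>L0_order M\<^esub> F \<in> L0 M"
    and "AE w in M. L0_rep (\<Squnion>\<^bsub>L0_order M\<^esub> F) w = Max ((\<lambda>X. L0_rep X w) ` F)"
proof -
  let ?m = "\<lambda>w. Max ((\<lambda>X. L0_rep X w) ` F)"
  let ?S = "L0_class M ?m"
  have meas: "?m \<in> borel_measurable M"
    using assms by (intro borel_measurable_Max) (auto intro: L0_rep_measurable)
  note rep = L0_rep_class[OF meas]
  have "least (L0_order M) ?S (Upper (L0_order M) F)"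
  proof (rule least_UpperI)
    fix X assume "X \<in> F"
    then have le: "L0_rep X w \<le> ?m w" for w
      using assms(1) by (intro Max_ge) auto
    from rep(2) have "AE w in M. L0_rep X w \<le> L0_rep ?S w"
      by eventually_elim (simp add: le)
    then show "X \<sqsubseteq>\<^bsub>L0_order M\<^esub> ?S" by (simp add: L0_order_def)
  next
    fix Y assume "Y \<in> Upper (L0_order M) F"
    then have "AE w in M. L0_rep X w \<le> L0_rep Y w" if "X \<in> F" for X
      using that assms(3) by (auto simp: Upper_def L0_order_def)
    then have "AE w in M. \<forall>X\<in>F. L0_rep X w \<le> L0_rep Y w"
      using assms(1) by (intro AE_finite_allI) auto
    with rep(2) have "AE w in M. L0_rep ?S w \<le> L0_rep Y w"
    proof eventually_elim
      case (elim w)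
      have "?m w \<le> L0_rep Y w" using elim(2) assms(1,2) by (intro Max.boundedI) auto
      then show ?case using elim(1) by simp
    qed
    then show "?S \<sqsubseteq>\<^bsub>L0_order M\<^esub> Y" by (simp add: L0_order_def)
  qed (use assms L0_class_in_L0[OF meas] in \<open>auto simp: L0_order_def\<close>)
  \<comment> \<open>The lattice supremum is a Hilbert choice among least upper bounds. Existence
    shows that the chosen class is one of them; antisymmetry up to null sets then forces it to be
    \<open>?S\<close>.\<close>
  then have "least (L0_order M) (\<Squnion>\<^bsub>L0_order M\<^esub> F) (Upper (L0_order M) F)"
    unfolding sup_def by (rule someI[of "\<lambda>X. least (L0_order M) X (Upper (L0_order M) F)"])
  moreover note \<open>least (L0_order M) ?S (Upper (L0_order M) F)\<close>
  moreover have "X = Y" if "least (L0_order M) X U" "least (L0_order M) Y U" "U \<subseteq> L0 M" for X Y U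
  proof (rule L0_eqI)
    show "X \<in> L0 M" "Y \<in> L0 M" using that by (auto simp: least_def)
    have "AE w in M. L0_rep X w \<le> L0_rep Y w" "AE w in M. L0_rep Y w \<le> L0_rep X w"
      using that by (auto simp: least_def L0_order_def)
    then show "AE w in M. L0_rep X w = L0_rep Y w" by eventually_elim simp
  qed
  moreover have "Upper (L0_order M) F \<subseteq> L0 M"
    by (auto simp: Upper_def L0_order_def)
  ultimately have "\<Squnion>\<^bsub>L0_order M\<^esub> F = ?S"
    by blast
  then show "\<Squnion>\<^bsub>L0_order M\<^esub> F \<in> L0 M"
    "AE w in M. L0_rep (\<Squnion>\<^bsub>L0_order M\<^esub> F) w = ?m w"
    using L0_class_in_L0[OF meas] rep(2) by simp_all
qed


section \<open>Closures in a topology given by a local base\<close>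

text \<open>Open sets are defined through the base, but the translates \<open>x + B\<close> need not
  be open themselves. The halving condition puts an open set containing \<open>x\<close> inside each
  of them, which gives the usual test for adherent points.\<close>

lemma closure_of_local_base_topology:
  assumes E: "abelian_group E"
    and ne: "\<U> \<noteq> {}"
    and directed: "\<And>B C. B \<in> \<U> \<Longrightarrow> C \<in> \<U> \<Longrightarrow> \<exists>D\<in>\<U>. D \<subseteq> B \<inter> C"
    and sub: "\<And>B. B \<in> \<U> \<Longrightarrow> B \<subseteq> carrier E"
    and zero: "\<And>B. B \<in> \<U> \<Longrightarrow> \<zero>\<^bsub>E\<^esub> \<in> B"
    and half: "\<And>B. B \<in> \<U> \<Longrightarrow> \<exists>C\<in>\<U>. \<forall>x\<in>C. \<forall>y\<in>C. x \<oplus>\<^bsub>E\<^esub> y \<in> B"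
    and G: "G \<subseteq> carrier E"
  shows "local_base_topology E \<U> closure_of G
    = {x \<in> carrier E. \<forall>B\<in>\<U>. \<exists>y\<in>G. y \<ominus>\<^bsub>E\<^esub> x \<in> B}"
proof -
  interpret abelian_group E by (rule E)
  let ?T = "local_base_topology E \<U>"
  have op: "openin ?T U \<longleftrightarrow> U \<subseteq> carrier E \<and> (\<forall>x\<in>U. \<exists>B\<in>\<U>. x <+\<^bsub>E\<^esub> B \<subseteq> U)" for U
    by (rule openin_local_base_topology) (rule directed)
  have coset: "x <+\<^bsub>E\<^esub> B = {x \<oplus>\<^bsub>E\<^esub> b | b. b \<in> B}" for x B
    by (auto simp: a_l_coset_def l_coset_def)
  have top: "topspace ?T = carrier E"
  proof
    show "topspace ?T \<subseteq> carrier E"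
      using openin_topspace[of ?T] unfolding op by blast
    have "openin ?T (carrier E)"
      unfolding op
    proof (intro conjI ballI)
      fix x assume x: "x \<in> carrier E"
      obtain B where B: "B \<in> \<U>" using ne by blast
      then have "x <+\<^bsub>E\<^esub> B \<subseteq> carrier E"
        using sub[OF B] x by (auto simp: coset intro: a_closed)
      with B show "\<exists>B\<in>\<U>. x <+\<^bsub>E\<^esub> B \<subseteq> carrier E" ..
    qed simp
    then show "carrier E \<subseteq> topspace ?T" by (rule openin_subset)
  qed
  have add_diff: "x \<oplus>\<^bsub>E\<^esub> (y \<ominus>\<^bsub>E\<^esub> x) = y" if "x \<in> carrier E" "y \<in> carrier E" for x y
    using that by (simp add: minus_eq a_comm[of y] r_neg2)
  show ?thesis
  proof (intro subset_antisym subsetI)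
    fix x assume x: "x \<in> ?T closure_of G"
    have xE: "x \<in> carrier E" using x by (simp add: in_closure_of top)
    moreover have "\<exists>y\<in>G. y \<ominus>\<^bsub>E\<^esub> x \<in> B" if B: "B \<in> \<U>" for B
    proof -
      \<comment> \<open>The candidate for the interior of \<open>x + B\<close>: all points with a
        whole basic translate inside \<open>x + B\<close>. It is open because, with
        \<open>D + D\<close> contained in \<open>C\<close>, each \<open>y + a\<close> for
        \<open>a\<close> in \<open>D\<close> satisfies \<open>(y + a) + D\<close> inside
        \<open>y + C\<close>.\<close>
      let ?V = "{y \<in> carrier E. \<exists>C\<in>\<U>. y <+\<^bsub>E\<^esub> C \<subseteq> x <+\<^bsub>E\<^esub> B}"
      have "openin ?T ?V"
        unfolding op
      proof (intro conjI ballI)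
        fix y assume "y \<in> ?V"
        then obtain C where C: "y \<in> carrier E" "C \<in> \<U>" "y <+\<^bsub>E\<^esub> C \<subseteq> x <+\<^bsub>E\<^esub> B" by auto
        obtain D where D: "D \<in> \<U>" "\<And>a b. a \<in> D \<Longrightarrow> b \<in> D \<Longrightarrow> a \<oplus>\<^bsub>E\<^esub> b \<in> C"
          using half[OF C(2)] by auto
        have "y \<oplus>\<^bsub>E\<^esub> a \<in> ?V" if a: "a \<in> D" for a
        proof -
          have "(y \<oplus>\<^bsub>E\<^esub> a) <+\<^bsub>E\<^esub> D \<subseteq> y <+\<^bsub>E\<^esub> C"
          proof
            fix z assume "z \<in> (y \<oplus>\<^bsub>E\<^esub> a) <+\<^bsub>E\<^esub> D"
            then obtain b where b: "b \<in> D" "z = (y \<oplus>\<^bsub>E\<^esub> a) \<oplus>\<^bsub>E\<^esub> b" by (auto simp: coset)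
            then have "z = y \<oplus>\<^bsub>E\<^esub> (a \<oplus>\<^bsub>E\<^esub> b)"
              using a b C(1) sub[OF D(1)] by (auto intro: a_assoc)
            then show "z \<in> y <+\<^bsub>E\<^esub> C" using D(2)[OF a b(1)] by (auto simp: coset)
          qed
          then show ?thesis using C D a sub[OF D(1)] by blast
        qed
        then show "\<exists>B'\<in>\<U>. y <+\<^bsub>E\<^esub> B' \<subseteq> ?V"
          by (intro bexI[OF _ D(1)]) (auto simp: coset)
      qed auto
      moreover have "\<exists>y. y \<in> G \<and> y \<in> T" if "x \<in> T" "openin ?T T" for T
        using x that by (auto simp: in_closure_of)
      note meets = this[of ?V]
      moreover have "x \<in> ?V" using xE B by auto
      ultimately obtain y where y: "y \<in> G" "y \<in> ?V"
        using meets by blast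
      then obtain C where C: "C \<in> \<U>" "y <+\<^bsub>E\<^esub> C \<subseteq> x <+\<^bsub>E\<^esub> B" "y \<in> carrier E" by blast
      \<comment> \<open>Zero lies in every base set, so \<open>y\<close> itself lies in
        \<open>y + C\<close> and hence in \<open>x + B\<close>; subtracting \<open>x\<close> gives
        an element of \<open>B\<close>.\<close>
      have "y = y \<oplus>\<^bsub>E\<^esub> \<zero>\<^bsub>E\<^esub>" using C(3) by simp
      then have "y \<in> y <+\<^bsub>E\<^esub> C" using zero[OF C(1)] unfolding coset by blast
      then obtain b where b: "b \<in> B" "y = x \<oplus>\<^bsub>E\<^esub> b" using C(2) unfolding coset by blast
      have "b \<in> carrier E" using b(1) sub[OF B] by blast
      then have "y \<ominus>\<^bsub>E\<^esub> x = b"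
        using xE b(2) by (simp add: minus_eq a_comm[of x b] a_assoc r_neg)
      then show ?thesis using b(1) y(1) by (intro bexI[of _ y]) simp_all
    qed
    ultimately show "x \<in> {x \<in> carrier E. \<forall>B\<in>\<U>. \<exists>y\<in>G. y \<ominus>\<^bsub>E\<^esub> x \<in> B}" by blast
  next
    fix x assume x: "x \<in> {x \<in> carrier E. \<forall>B\<in>\<U>. \<exists>y\<in>G. y \<ominus>\<^bsub>E\<^esub> x \<in> B}"
    show "x \<in> ?T closure_of G"
      unfolding in_closure_of top
    proof (intro conjI allI impI; (elim conjE)?)
      show "x \<in> carrier E" using x by simp
      fix U assume "x \<in> U" "openin ?T U"
      then obtain B where B: "B \<in> \<U>" "x <+\<^bsub>E\<^esub> B \<subseteq> U" unfolding op by blast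
      obtain y where y: "y \<in> G" "y \<ominus>\<^bsub>E\<^esub> x \<in> B" using x B by auto
      have "y = x \<oplus>\<^bsub>E\<^esub> (y \<ominus>\<^bsub>E\<^esub> x)" using add_diff x y G by auto
      then have "y \<in> U" using y B by (auto simp: coset)
      then show "\<exists>y. y \<in> G \<and> y \<in> U" using y by auto
    qed
  qed
qed

section \<open>Random locally convex modules\<close>

lemma countable_partition_disjointed:
  assumes "range B \<subseteq> sets M" "(\<Union>n. B n) = space M"
  shows "countable_partition M (disjointed B)"
  unfolding countable_partition_def
  using assms sets.range_disjointed_sets[of B M]
  by (simp add: disjoint_family_disjointed UN_disjointed_eq)

lemma AE_countable_partition:
  assumes "countable_partition M A" "\<And>n. AE w in M. w \<in> A n \<longrightarrow> P w"
  shows "AE w in M. P w"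
proof -
  have "AE w in M. \<forall>n. w \<in> A n \<longrightarrow> P w"
    unfolding AE_all_countable using assms(2) by blast
  moreover have "AE w in M. w \<in> (\<Union>n. A n)"
    using assms(1) AE_space[of M] by (simp only: countable_partition_def)
  ultimately show ?thesis by eventually_elim auto
qed

text \<open>Inclusion-exclusion: the probabilities lost by two events at most add up. This is what
  lets two approximations, each valid with high probability, be used together.\<close>

lemma (in prob_space) prob_Int_gt:
  assumes "A \<in> events" "B \<in> events" "1 - a < prob A" "1 - b < prob B"
  shows "1 - (a + b) < prob (A \<inter> B)"
proof -
  have "prob (A \<union> B) = prob A + prob B - prob (A \<inter> B)"
    using assms(1,2) by (intro measure_Un3) (auto simp: fmeasurable_eq_sets)
  moreover have "prob (A \<union> B) \<le> 1" by simp
  ultimately show ?thesis using assms(3,4) by linarith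
qed

lemma (in prob_space) prob_incseq_gt:
  assumes "range A \<subseteq> events" "incseq A" "prob (\<Union>n. A n) = 1" "0 < l"
  obtains n where "1 - l < prob (A n)"
proof -
  have "(\<lambda>n. prob (A n)) \<longlonglongrightarrow> 1"
    using finite_Lim_measure_incseq[OF assms(1,2)] assms(3) by simp
  then have "eventually (\<lambda>n. 1 - l < prob (A n)) sequentially"
    by (rule order_tendstoD) (use assms(4) in simp)
  then show ?thesis using that by (auto simp: eventually_sequentially)
qed

text \<open>The sets where \<open>f\<close> exceeds \<open>1 / (n + 1)\<close> increase to a set of
  probability one. An almost surely positive random tolerance can thus be replaced by a real
  constant at an arbitrarily small cost in probability.\<close>

lemma (in prob_space) prob_above_constant:
  fixes f :: "'a \<Rightarrow> real"
  assumes [measurable]: "f \<in> borel_measurable M" and pos: "AE w in M. 0 < f w" and "0 < l"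
  obtains e where "0 < e" "1 - l < prob {w \<in> space M. e < f w}"
proof -
  let ?A = "\<lambda>n. {w \<in> space M. inverse (real (Suc n)) < f w}"
  have "(\<Union>n. ?A n) = {w \<in> space M. 0 < f w}"
    by (auto simp del: of_nat_Suc dest: reals_Archimedean
        less_trans[OF inverse_positive_iff_positive[THEN iffD2, OF of_nat_0_less_iff[THEN iffD2, OF zero_less_Suc]]])
  moreover have "prob {w \<in> space M. 0 < f w} = 1"
    using pos by (intro prob_eq_1[THEN iffD2]) auto
  moreover have "inverse (real (Suc (Suc n))) \<le> inverse (real (Suc n))" for n by simp
  then have "incseq ?A"
    by (intro incseq_SucI) (blast intro: le_less_trans)
  moreover have "range ?A \<subseteq> events" by auto
  ultimately obtain n where "1 - l < prob (?A n)"
    using prob_incseq_gt[of ?A l] \<open>0 < l\<close> by metis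
  then show ?thesis by (intro that[of "inverse (real (Suc n))"]) auto
qed

section \<open>Pointwise rules for the seminorms\<close>

locale random_lc =
  fixes M :: "'w measure"
    and E :: "(('w \<Rightarrow> 'k::{real_normed_field, euclidean_space}) set, 'e) module"
    and N :: "('e \<Rightarrow> ('w \<Rightarrow> real) set) set"
  assumes random_lc_module: "random_lc_module M E N"
begin

sublocale prob_space M
  using random_lc_module by (simp add: random_lc_module_def)

sublocale mod: module "L0_ring M" E
  using random_lc_module by (simp add: random_lc_module_def)

abbreviation ind :: "'w set \<Rightarrow> ('w \<Rightarrow> 'k) set" where
  "ind A \<equiv> L0_ind M A"

lemma ind_in_carrier: "A \<in> events \<Longrightarrow> ind A \<in> carrier (L0_ring M)"
  by (rule L0_ind_in_carrier)

lemma seminorm: "p \<in> N \<Longrightarrow> L0_seminorm M E p"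
  using random_lc_module by (simp add: random_lc_module_def)

lemma seminorm_in_L0: "p \<in> N \<Longrightarrow> x \<in> carrier E \<Longrightarrow> p x \<in> L0 M"
  using seminorm by (auto simp: L0_seminorm_def L0_nonneg_def)

lemma seminorm_measurable:
  "p \<in> N \<Longrightarrow> x \<in> carrier E \<Longrightarrow> L0_rep (p x) \<in> borel_measurable M"
  by (intro L0_rep_measurable seminorm_in_L0)

text \<open>Without seminorms every class bounds the empty family from above, so the zero class
  would be the least element of \<open>L0 M\<close>; the class of \<open>- 1\<close> contradicts
  this. Consequently the two bases, which are built from nonempty finite subfamilies, are
  nonempty.\<close>

lemma seminorms_nonempty: "N \<noteq> {}"
proof
  assume "N = {}"
  let ?Y = "L0_class M (\<lambda>_. - 1 :: real)"
  have "least (L0_order M) \<zero>\<^bsub>L0_ring M\<^esub> (Upper (L0_order M) {})"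
    using random_lc_module \<open>N = {}\<close> mod.M.zero_closed by (auto simp: random_lc_module_def)
  moreover have "?Y \<in> Upper (L0_order M) {}"
    by (simp add: Upper_def L0_order_def L0_class_in_L0)
  ultimately have "AE w in M. L0_rep (L0_class M (\<lambda>_. 0 :: real)) w \<le> L0_rep ?Y w"
    by (auto simp: least_def L0_order_def L0_ring_def)
  moreover have "AE w in M. L0_rep (L0_class M (\<lambda>_. 0 :: real)) w = 0"
    "AE w in M. L0_rep ?Y w = - 1"
    by (rule L0_rep_class; simp)+
  ultimately have "AE w in M. False" by eventually_elim simp
  then show False by simp
qed

lemma seminorm_add:
  assumes p: "p \<in> N" and x: "x \<in> carrier E" "y \<in> carrier E"
  shows "AE w in M. L0_rep (p (x \<oplus>\<^bsub>E\<^esub> y)) w \<le> L0_rep (p x) w + L0_rep (p y) w"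
proof -
  have "AE w in M. L0_rep (p (x \<oplus>\<^bsub>E\<^esub> y)) w
      \<le> L0_rep (L0_class M (\<lambda>w. L0_rep (p x) w + L0_rep (p y) w)) w"
    using seminorm[OF p] x by (simp add: L0_seminorm_def L0_order_def L0_ring_def)
  moreover have "(\<lambda>w. L0_rep (p x) w + L0_rep (p y) w) \<in> borel_measurable M"
    using p x by (intro borel_measurable_add seminorm_measurable)
  note L0_rep_class(2)[OF this]
  ultimately show ?thesis by eventually_elim simp
qed

lemma seminorm_ind:
  assumes p: "p \<in> N" and x: "x \<in> carrier E" and A: "A \<in> events"
  shows "AE w in M. L0_rep (p (ind A \<odot>\<^bsub>E\<^esub> x)) w = indicator A w * L0_rep (p x) w"
proof -
  let ?i = "L0_rep (ind A)" and ?a = "L0_rep (L0_abs M (ind A))"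
  have A': "(indicator A :: 'w \<Rightarrow> 'k) \<in> borel_measurable M" using A by auto
  note i = L0_rep_class[OF A', folded L0_ind_def]
  have "(\<lambda>w. norm (?i w)) \<in> borel_measurable M" using i(1) by measurable
  note a = L0_rep_class[OF this, folded L0_abs_def]
  have "(\<lambda>w. ?a w * L0_rep (p x) w) \<in> borel_measurable M"
    using a(1) seminorm_measurable[OF p x] by measurable
  note m = L0_rep_class(2)[OF this]
  have eq: "p (ind A \<odot>\<^bsub>E\<^esub> x) = L0_class M (\<lambda>w. ?a w * L0_rep (p x) w)"
    using seminorm[OF p] x ind_in_carrier[OF A]
    by (simp add: L0_seminorm_def L0_ring_def)
  from m a(2) i(2) show ?thesis
    unfolding eq by eventually_elim (simp add: indicator_def)
qed

text \<open>Multiplying zero by the indicator of the empty event leaves zero unchanged, while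
  \<open>seminorm_ind\<close> makes the value of the seminorm vanish.\<close>

lemma seminorm_zero:
  assumes "p \<in> N"
  shows "AE w in M. L0_rep (p \<zero>\<^bsub>E\<^esub>) w = 0"
  using seminorm_ind[OF assms mod.M.zero_closed sets.empty_sets] by (simp add: L0_ind_empty)

text \<open>Locality: since \<open>p (ind A z)\<close> is the indicator of \<open>A\<close> times
  \<open>p z\<close>, the value of a seminorm on \<open>A\<close> depends only on the part of its
  argument over \<open>A\<close>. This carries estimates from the pieces of a concatenation to the
  whole.\<close>

lemma seminorm_local:
  assumes p: "p \<in> N" and A: "A \<in> events"
    and car: "x \<in> carrier E" "x' \<in> carrier E" "y \<in> carrier E" "y' \<in> carrier E"
    and eq: "ind A \<odot>\<^bsub>E\<^esub> x = ind A \<odot>\<^bsub>E\<^esub> x'" "ind A \<odot>\<^bsub>E\<^esub> y = ind A \<odot>\<^bsub>E\<^esub> y'"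
  shows "AE w in M. w \<in> A \<longrightarrow> L0_rep (p (x \<ominus>\<^bsub>E\<^esub> y)) w = L0_rep (p (x' \<ominus>\<^bsub>E\<^esub> y')) w"
proof -
  have "ind A \<odot>\<^bsub>E\<^esub> (x \<ominus>\<^bsub>E\<^esub> y) = ind A \<odot>\<^bsub>E\<^esub> (x' \<ominus>\<^bsub>E\<^esub> y')"
    using car eq ind_in_carrier[OF A]
    by (simp add: mod.M.minus_eq mod.smult_r_distr mod.smult_r_minus)
  then show ?thesis
    using seminorm_ind[OF p _ A, of "x \<ominus>\<^bsub>E\<^esub> y"] seminorm_ind[OF p _ A, of "x' \<ominus>\<^bsub>E\<^esub> y'"] car
    by (simp add: mod.M.minus_closed, elim AE_mp[OF _ AE_mp]) (auto intro!: AE_I2 simp: indicator_def)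
qed


subsection \<open>The two closures\<close>

text \<open>The basic neighbourhood with the supremum over \<open>Q\<close> unfolded into a
  pointwise quantifier over representatives. By \<open>epsilon_lambda_base_eq\<close> these sets
  form exactly the original base.\<close>

definition el_ball :: "('e \<Rightarrow> ('w \<Rightarrow> real) set) set \<Rightarrow> real \<Rightarrow> real \<Rightarrow> 'e set" where
  "el_ball Q e l
    = {x \<in> carrier E. 1 - l < prob {w \<in> space M. \<forall>p\<in>Q. L0_rep (p x) w < e}}"

text \<open>The radius is a measurable function instead of a class, so that it can be halved,
  minimised and compared pointwise. The link with the base is
  \<open>locally_L0_convex_base_eq\<close>.\<close>

definition c_ball :: "('e \<Rightarrow> ('w \<Rightarrow> real) set) set \<Rightarrow> ('w \<Rightarrow> real) \<Rightarrow> 'e set" where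
  "c_ball Q f = {x \<in> carrier E. AE w in M. \<forall>p\<in>Q. L0_rep (p x) w \<le> f w}"

definition admissible :: "('e \<Rightarrow> ('w \<Rightarrow> real) set) set \<Rightarrow> bool" where
  "admissible Q \<longleftrightarrow> Q \<subseteq> N \<and> finite Q \<and> Q \<noteq> {}"

lemma admissible_Un: "admissible Q \<Longrightarrow> admissible Q' \<Longrightarrow> admissible (Q \<union> Q')"
  by (auto simp: admissible_def)

lemma admissible_exists: obtains Q where "admissible Q"
  using seminorms_nonempty by (metis admissible_def empty_subsetI finite.emptyI finite.insertI
      insert_not_empty insert_subset ex_in_conv)

lemma events_less:
  assumes Q: "admissible Q" and x: "x \<in> carrier E"
  shows "{w \<in> space M. \<forall>p\<in>Q. L0_rep (p x) w < e} \<in> events"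
proof -
  have "{w \<in> space M. L0_rep (p x) w < e} \<in> events" if "p \<in> Q" for p
    using seminorm_measurable[of p x] that Q x by (auto simp: admissible_def)
  then show ?thesis
    using Q by (intro sets.sets_Collect_finite_All) (auto simp: admissible_def)
qed

lemma events_le:
  assumes Q: "admissible Q" and x: "x \<in> carrier E" and f: "f \<in> borel_measurable M"
  shows "{w \<in> space M. \<forall>p\<in>Q. L0_rep (p x) w \<le> f w} \<in> events"
proof -
  have "{w \<in> space M. L0_rep (p x) w \<le> f w} \<in> events" if "p \<in> Q" for p
    using seminorm_measurable[of p x] that Q x f
    by (intro borel_measurable_le) (auto simp: admissible_def)
  then show ?thesis
    using Q by (intro sets.sets_Collect_finite_All) (auto simp: admissible_def)
qed

lemma fin_sup_seminorm:
  assumes Q: "admissible Q" and x: "x \<in> carrier E"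
  shows "L0_rep (fin_sup_seminorm M Q x) \<in> borel_measurable M"
    and "AE w in M. L0_rep (fin_sup_seminorm M Q x) w = Max ((\<lambda>p. L0_rep (p x) w) ` Q)"
proof -
  have F: "finite ((\<lambda>p. p x) ` Q)" "(\<lambda>p. p x) ` Q \<noteq> {}" "(\<lambda>p. p x) ` Q \<subseteq> L0 M"
    using Q x seminorm_in_L0 by (auto simp: admissible_def)
  note s = L0_rep_finite_sup[OF F, folded fin_sup_seminorm_def]
  show "L0_rep (fin_sup_seminorm M Q x) \<in> borel_measurable M"
    by (rule L0_rep_measurable[OF s(1)])
  show "AE w in M. L0_rep (fin_sup_seminorm M Q x) w = Max ((\<lambda>p. L0_rep (p x) w) ` Q)"
    using s(2) by (simp add: image_image)
qed

lemma prob_fin_sup_seminorm_less: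
  assumes Q: "admissible Q" and x: "x \<in> carrier E"
  shows "prob {w \<in> space M. L0_rep (fin_sup_seminorm M Q x) w < e}
    = prob {w \<in> space M. \<forall>p\<in>Q. L0_rep (p x) w < e}"
proof (rule finite_measure_eq_AE)
  show "AE w in M. w \<in> {w \<in> space M. L0_rep (fin_sup_seminorm M Q x) w < e}
      \<longleftrightarrow> w \<in> {w \<in> space M. \<forall>p\<in>Q. L0_rep (p x) w < e}"
    using fin_sup_seminorm(2)[OF assms]
    by eventually_elim (use Q in \<open>auto simp: admissible_def\<close>)
  show "{w \<in> space M. L0_rep (fin_sup_seminorm M Q x) w < e} \<in> events"
    using fin_sup_seminorm(1)[OF assms] by measurable
qed (rule events_less[OF assms])

lemma epsilon_lambda_base_eq:
  "epsilon_lambda_base M E N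
    = {el_ball Q e l | Q e l. admissible Q \<and> 0 < e \<and> 0 < l \<and> l < 1}"
proof -
  have ball: "{x \<in> carrier E. measure M {w \<in> space M. L0_rep (fin_sup_seminorm M Q x) w < e} > 1 - l}
      = el_ball Q e l" if "Q \<subseteq> N" "finite Q" "Q \<noteq> {}" for Q e l
  proof -
    have "admissible Q" using that by (simp add: admissible_def)
    note prob_fin_sup_seminorm_less[OF this]
    then show ?thesis unfolding el_ball_def by (intro Collect_cong conj_cong) simp_all
  qed
  show ?thesis
    unfolding epsilon_lambda_base_def admissible_def
    by (intro Collect_cong ex_cong1; rule iffI; elim conjE; intro conjI; simp only: ball not_False_eq_True)
qed

text \<open>A finite nonempty maximum is bounded by \<open>f\<close> exactly when all its terms are.
  One inclusion takes a representative of the radius, the other the class of the radius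
  function.\<close>

lemma locally_L0_convex_base_eq:
  "locally_L0_convex_base M E N
    = {c_ball Q f | Q f. admissible Q \<and> f \<in> borel_measurable M \<and> (AE w in M. 0 < f w)}"
proof -
  have le: "{x \<in> carrier E. fin_sup_seminorm M Q x \<sqsubseteq>\<^bsub>L0_order M\<^esub> X} = c_ball Q f"
    if "admissible Q" "AE w in M. L0_rep X w = f w" for Q X f
  proof -
    have "(AE w in M. L0_rep (fin_sup_seminorm M Q x) w \<le> L0_rep X w)
        \<longleftrightarrow> (AE w in M. \<forall>p\<in>Q. L0_rep (p x) w \<le> f w)" if "x \<in> carrier E" for x
    proof -
      have "AE w in M. L0_rep (fin_sup_seminorm M Q x) w \<le> L0_rep X w
          \<longleftrightarrow> (\<forall>p\<in>Q. L0_rep (p x) w \<le> f w)"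
        using fin_sup_seminorm(2)[OF \<open>admissible Q\<close> that] \<open>AE w in M. L0_rep X w = f w\<close>
        by eventually_elim (use \<open>admissible Q\<close> in \<open>auto simp: admissible_def\<close>)
      then show ?thesis by (rule eventually_subst)
    qed
    then show ?thesis by (simp add: c_ball_def L0_order_def cong: conj_cong)
  qed
  show ?thesis (is "?L = ?R")
  proof (intro subset_antisym subsetI)
    fix B assume "B \<in> ?L"
    then obtain Q X where B: "B = {x \<in> carrier E. fin_sup_seminorm M Q x \<sqsubseteq>\<^bsub>L0_order M\<^esub> X}"
      "admissible Q" "X \<in> L0_pos M"
      unfolding locally_L0_convex_base_def admissible_def by auto
    have "B = c_ball Q (L0_rep X)" unfolding B(1) by (rule le[OF B(2)]) simp
    then show "B \<in> ?R" using B(2,3) L0_rep_measurable[of X M] by (auto simp: L0_pos_def)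
  next
    fix B assume "B \<in> ?R"
    then obtain Q f where B: "B = c_ball Q f" "admissible Q" "f \<in> borel_measurable M"
      "AE w in M. 0 < f w" by auto
    note f = L0_rep_class(2)[OF B(3)]
    have "AE w in M. 0 < L0_rep (L0_class M f) w" using f B(4) by eventually_elim simp
    then have "L0_class M f \<in> L0_pos M" by (simp add: L0_pos_def L0_class_in_L0 B(3))
    moreover have "B = {x \<in> carrier E. fin_sup_seminorm M Q x \<sqsubseteq>\<^bsub>L0_order M\<^esub> L0_class M f}"
      unfolding B(1) by (rule le[symmetric, OF B(2) f])
    ultimately show "B \<in> ?L"
      using B(2) unfolding locally_L0_convex_base_def admissible_def by blast
  qed
qed

lemma el_ball_mono:
  assumes "admissible Q" "admissible Q'" "Q \<subseteq> Q'" "e' \<le> e" "l' \<le> l"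
  shows "el_ball Q' e' l' \<subseteq> el_ball Q e l"
proof
  fix x assume x: "x \<in> el_ball Q' e' l'"
  then have "prob {w \<in> space M. \<forall>p\<in>Q'. L0_rep (p x) w < e'}
      \<le> prob {w \<in> space M. \<forall>p\<in>Q. L0_rep (p x) w < e}"
    using assms by (intro finite_measure_mono events_less) (force simp: el_ball_def)+
  then show "x \<in> el_ball Q e l" using x assms(5) by (auto simp: el_ball_def)
qed

lemma c_ball_mono:
  assumes "Q \<subseteq> Q'" "AE w in M. f' w \<le> f w"
  shows "c_ball Q' f' \<subseteq> c_ball Q f"
proof
  fix x assume x: "x \<in> c_ball Q' f'"
  then have "AE w in M. \<forall>p\<in>Q'. L0_rep (p x) w \<le> f' w" by (simp add: c_ball_def)
  with assms(2) have "AE w in M. \<forall>p\<in>Q. L0_rep (p x) w \<le> f w"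
    by eventually_elim (meson assms(1) order_trans subsetD)
  then show "x \<in> c_ball Q f" using x by (simp add: c_ball_def)
qed

lemma seminorms_add:
  assumes "admissible Q" "x \<in> carrier E" "y \<in> carrier E"
  shows "AE w in M. \<forall>p\<in>Q. L0_rep (p (x \<oplus>\<^bsub>E\<^esub> y)) w \<le> L0_rep (p x) w + L0_rep (p y) w"
  using assms by (intro AE_finite_allI seminorm_add) (auto simp: admissible_def)

lemma seminorms_zero:
  assumes "admissible Q"
  shows "AE w in M. \<forall>p\<in>Q. L0_rep (p \<zero>\<^bsub>E\<^esub>) w = 0"
  using assms by (intro AE_finite_allI seminorm_zero) (auto simp: admissible_def)

text \<open>Both the tolerance and the exceptional probability are split in half. On the
  intersection of the two good events the triangle inequality gives the full tolerance.\<close>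

lemma el_ball_add:
  assumes Q: "admissible Q" and x: "x \<in> el_ball Q (e / 2) (l / 2)" "y \<in> el_ball Q (e / 2) (l / 2)"
  shows "x \<oplus>\<^bsub>E\<^esub> y \<in> el_ball Q e l"
proof -
  have car: "x \<in> carrier E" "y \<in> carrier E" using x by (auto simp: el_ball_def)
  let ?S = "\<lambda>z e. {w \<in> space M. \<forall>p\<in>Q. L0_rep (p z) w < e}"
  have "1 - (l / 2 + l / 2) < prob (?S x (e / 2) \<inter> ?S y (e / 2))"
    using x by (intro prob_Int_gt events_less[OF Q] car) (simp_all add: el_ball_def)
  also have "\<dots> \<le> prob (?S (x \<oplus>\<^bsub>E\<^esub> y) e)"
  proof (rule finite_measure_mono_AE)
    show "AE w in M. w \<in> ?S x (e / 2) \<inter> ?S y (e / 2) \<longrightarrow> w \<in> ?S (x \<oplus>\<^bsub>E\<^esub> y) e"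
      using seminorms_add[OF Q car] by eventually_elim fastforce
  qed (use car in \<open>auto intro: events_less[OF Q]\<close>)
  finally show ?thesis using car by (simp add: el_ball_def)
qed

lemma c_ball_add:
  assumes Q: "admissible Q" and x: "x \<in> c_ball Q (\<lambda>w. f w / 2)" "y \<in> c_ball Q (\<lambda>w. f w / 2)"
  shows "x \<oplus>\<^bsub>E\<^esub> y \<in> c_ball Q f"
proof -
  have car: "x \<in> carrier E" "y \<in> carrier E" using x by (auto simp: c_ball_def)
  have "AE w in M. \<forall>p\<in>Q. L0_rep (p x) w \<le> f w / 2" "AE w in M. \<forall>p\<in>Q. L0_rep (p y) w \<le> f w / 2"
    using x by (auto simp: c_ball_def)
  with seminorms_add[OF Q car] have "AE w in M. \<forall>p\<in>Q. L0_rep (p (x \<oplus>\<^bsub>E\<^esub> y)) w \<le> f w"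
    by eventually_elim fastforce
  then show ?thesis using car by (simp add: c_ball_def)
qed

lemma zero_in_el_ball:
  assumes Q: "admissible Q" and "0 < e" "0 < l"
  shows "\<zero>\<^bsub>E\<^esub> \<in> el_ball Q e l"
proof -
  have "AE w in M. w \<in> {w \<in> space M. \<forall>p\<in>Q. L0_rep (p \<zero>\<^bsub>E\<^esub>) w < e}"
    using seminorms_zero[OF Q] AE_space by eventually_elim (use \<open>0 < e\<close> in simp)
  then have "prob {w \<in> space M. \<forall>p\<in>Q. L0_rep (p \<zero>\<^bsub>E\<^esub>) w < e} = 1"
    by (intro prob_eq_1[THEN iffD2] events_less[OF Q]) simp_all
  then show ?thesis using \<open>0 < l\<close> by (simp add: el_ball_def)
qed

lemma zero_in_c_ball:
  assumes Q: "admissible Q" and "AE w in M. 0 < f w"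
  shows "\<zero>\<^bsub>E\<^esub> \<in> c_ball Q f"
proof -
  have "AE w in M. \<forall>p\<in>Q. L0_rep (p \<zero>\<^bsub>E\<^esub>) w \<le> f w"
    using seminorms_zero[OF Q] assms(2) by eventually_elim simp
  then show ?thesis by (simp add: c_ball_def)
qed

section \<open>Closures tested on balls\<close>

lemma in_epsilon_lambda_closure:
  assumes "G \<subseteq> carrier E"
  shows "x \<in> epsilon_lambda_topology M E N closure_of G \<longleftrightarrow> x \<in> carrier E \<and>
    (\<forall>Q e l. admissible Q \<longrightarrow> 0 < e \<longrightarrow> 0 < l \<longrightarrow> l < 1 \<longrightarrow> (\<exists>y\<in>G. y \<ominus>\<^bsub>E\<^esub> x \<in> el_ball Q e l))"
proof -
  let ?U = "epsilon_lambda_base M E N"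
  have "local_base_topology E ?U closure_of G
      = {x \<in> carrier E. \<forall>B\<in>?U. \<exists>y\<in>G. y \<ominus>\<^bsub>E\<^esub> x \<in> B}"
  proof (rule closure_of_local_base_topology[OF mod.M.abelian_group_axioms _ _ _ _ _ assms])
    obtain Q where "admissible Q" by (rule admissible_exists)
    then have "el_ball Q 1 (1/2) \<in> ?U"
      unfolding epsilon_lambda_base_eq by (intro CollectI exI[of _ Q] exI conjI) auto
    then show "?U \<noteq> {}" by blast
  next
    fix B C assume "B \<in> ?U" "C \<in> ?U"
    then obtain Q e l Q' e' l' where
      B: "B = el_ball Q e l" "admissible Q" "0 < e" "0 < l" "l < 1" and
      C: "C = el_ball Q' e' l'" "admissible Q'" "0 < e'" "0 < l'" "l' < 1"
      unfolding epsilon_lambda_base_eq by blast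
    let ?D = "el_ball (Q \<union> Q') (min e e') (min l l')"
    have Q: "admissible (Q \<union> Q')" by (rule admissible_Un[OF B(2) C(2)])
    have "?D \<in> ?U"
      unfolding epsilon_lambda_base_eq using B C Q
      by (intro CollectI exI[of _ "Q \<union> Q'"] exI[of _ "min e e'"] exI[of _ "min l l'"]) auto
    moreover have "?D \<subseteq> B \<inter> C"
      unfolding B(1) C(1)
      by (intro Int_greatest el_ball_mono[OF B(2) Q] el_ball_mono[OF C(2) Q]) auto
    ultimately show "\<exists>D\<in>?U. D \<subseteq> B \<inter> C" by blast
  next
    fix B assume "B \<in> ?U"
    then obtain Q e l where B: "B = el_ball Q e l" "admissible Q" "0 < e" "0 < l" "l < 1"
      unfolding epsilon_lambda_base_eq by blast
    show "B \<subseteq> carrier E" by (auto simp: B(1) el_ball_def)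
    show "\<zero>\<^bsub>E\<^esub> \<in> B" unfolding B(1) by (rule zero_in_el_ball[OF B(2,3,4)])
    have "el_ball Q (e / 2) (l / 2) \<in> ?U"
      unfolding epsilon_lambda_base_eq using B
      by (intro CollectI exI[of _ Q] exI[of _ "e / 2"] exI[of _ "l / 2"]) auto
    then show "\<exists>C\<in>?U. \<forall>x\<in>C. \<forall>y\<in>C. x \<oplus>\<^bsub>E\<^esub> y \<in> B"
      using el_ball_add[OF B(2)] B(1) by blast
  qed
  then show ?thesis
    unfolding epsilon_lambda_topology_def epsilon_lambda_base_eq by blast
qed

lemma epsilon_lambda_closureE:
  assumes "G \<subseteq> carrier E" "x \<in> epsilon_lambda_topology M E N closure_of G"
    and "admissible Q" "0 < e" "0 < l" "l < 1"
  obtains y where "y \<in> G" "y \<ominus>\<^bsub>E\<^esub> x \<in> el_ball Q e l"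
  using assms(2-) unfolding in_epsilon_lambda_closure[OF assms(1)] by meson

lemma in_locally_L0_convex_closure:
  assumes "G \<subseteq> carrier E"
  shows "x \<in> locally_L0_convex_topology M E N closure_of G \<longleftrightarrow> x \<in> carrier E \<and>
    (\<forall>Q f. admissible Q \<longrightarrow> f \<in> borel_measurable M \<longrightarrow> (AE w in M. 0 < f w) \<longrightarrow>
      (\<exists>y\<in>G. y \<ominus>\<^bsub>E\<^esub> x \<in> c_ball Q f))"
proof -
  let ?U = "locally_L0_convex_base M E N"
  have "local_base_topology E ?U closure_of G
      = {x \<in> carrier E. \<forall>B\<in>?U. \<exists>y\<in>G. y \<ominus>\<^bsub>E\<^esub> x \<in> B}"
  proof (rule closure_of_local_base_topology[OF mod.M.abelian_group_axioms _ _ _ _ _ assms])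
    obtain Q where "admissible Q" by (rule admissible_exists)
    then have "c_ball Q (\<lambda>_. 1) \<in> ?U"
      unfolding locally_L0_convex_base_eq by (intro CollectI exI[of _ Q] exI conjI) auto
    then show "?U \<noteq> {}" by blast
  next
    fix B C assume "B \<in> ?U" "C \<in> ?U"
    then obtain Q f Q' f' where
      B: "B = c_ball Q f" "admissible Q" "f \<in> borel_measurable M" "AE w in M. 0 < f w" and
      C: "C = c_ball Q' f'" "admissible Q'" "f' \<in> borel_measurable M" "AE w in M. 0 < f' w"
      unfolding locally_L0_convex_base_eq by blast
    let ?f = "\<lambda>w. min (f w) (f' w)"
    have "AE w in M. 0 < ?f w" using B(4) C(4) by eventually_elim simp
    moreover have "?f \<in> borel_measurable M" using B(3) C(3) by measurable
    ultimately have "c_ball (Q \<union> Q') ?f \<in> ?U"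
      unfolding locally_L0_convex_base_eq using admissible_Un[OF B(2) C(2)] by blast
    moreover have "c_ball (Q \<union> Q') ?f \<subseteq> B \<inter> C"
      unfolding B(1) C(1) by (intro Int_greatest c_ball_mono) auto
    ultimately show "\<exists>D\<in>?U. D \<subseteq> B \<inter> C" by blast
  next
    fix B assume "B \<in> ?U"
    then obtain Q f where
      B: "B = c_ball Q f" "admissible Q" "f \<in> borel_measurable M" "AE w in M. 0 < f w"
      unfolding locally_L0_convex_base_eq by blast
    show "B \<subseteq> carrier E" by (auto simp: B(1) c_ball_def)
    show "\<zero>\<^bsub>E\<^esub> \<in> B" unfolding B(1) by (rule zero_in_c_ball[OF B(2,4)])
    have "(\<lambda>w. f w / 2) \<in> borel_measurable M" using B(3) by measurable
    then have "c_ball Q (\<lambda>w. f w / 2) \<in> ?U"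
      unfolding locally_L0_convex_base_eq using B
      by (intro CollectI exI[of _ Q] exI[of _ "\<lambda>w. f w / 2"]) auto
    then show "\<exists>C\<in>?U. \<forall>x\<in>C. \<forall>y\<in>C. x \<oplus>\<^bsub>E\<^esub> y \<in> B"
      using c_ball_add[OF B(2)] B(1) by blast
  qed
  then show ?thesis
    unfolding locally_L0_convex_topology_def locally_L0_convex_base_eq by blast
qed

lemma locally_L0_convex_closureE:
  assumes "G \<subseteq> carrier E" "x \<in> locally_L0_convex_topology M E N closure_of G"
    and "admissible Q" "f \<in> borel_measurable M" "AE w in M. 0 < f w"
  obtains y where "y \<in> G" "y \<ominus>\<^bsub>E\<^esub> x \<in> c_ball Q f"
  using assms(2-) unfolding in_locally_L0_convex_closure[OF assms(1)] by meson


subsection \<open>Concatenations\<close>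

text \<open>Regards a fixed element as a concatenation of itself along any partition, so that
  \<open>concatenation_diff_in_c_ball\<close> also compares a concatenation with a single
  point.\<close>

lemma concatenation_const: "x \<in> carrier E \<Longrightarrow> is_concatenation M E A (\<lambda>_. x) x"
  by (simp add: is_concatenation_def)

text \<open>On \<open>A n\<close> the element \<open>y - x\<close> may be replaced by
  \<open>Y n - X n\<close> by locality. The bounds on the pieces combine because countably many null
  sets have a null union; the same \<open>f\<close> serves on all pieces.\<close>

lemma concatenation_diff_in_c_ball:
  assumes Q: "admissible Q" and A: "countable_partition M A"
    and car: "range X \<subseteq> carrier E" "range Y \<subseteq> carrier E"
    and conc: "is_concatenation M E A X x" "is_concatenation M E A Y y"
    and le: "\<And>n. AE w in M. w \<in> A n \<longrightarrow> (\<forall>p\<in>Q. L0_rep (p (Y n \<ominus>\<^bsub>E\<^esub> X n)) w \<le> f w)"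
  shows "y \<ominus>\<^bsub>E\<^esub> x \<in> c_ball Q f"
proof -
  have xy: "x \<in> carrier E" "y \<in> carrier E"
    using conc by (auto simp: is_concatenation_def)
  have "AE w in M. \<forall>p\<in>Q. L0_rep (p (y \<ominus>\<^bsub>E\<^esub> x)) w \<le> f w"
  proof (rule AE_countable_partition[OF A])
    fix n
    have "AE w in M. w \<in> A n \<longrightarrow> L0_rep (p (y \<ominus>\<^bsub>E\<^esub> x)) w = L0_rep (p (Y n \<ominus>\<^bsub>E\<^esub> X n)) w"
      if "p \<in> Q" for p
      by (rule seminorm_local)
        (use that Q A xy car conc in \<open>auto simp: admissible_def countable_partition_def is_concatenation_def\<close>)
    then have "AE w in M. \<forall>p\<in>Q. w \<in> A n \<longrightarrow>
        L0_rep (p (y \<ominus>\<^bsub>E\<^esub> x)) w = L0_rep (p (Y n \<ominus>\<^bsub>E\<^esub> X n)) w"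
      using Q by (intro AE_finite_allI) (auto simp: admissible_def)
    with le[of n] show "AE w in M. w \<in> A n \<longrightarrow> (\<forall>p\<in>Q. L0_rep (p (y \<ominus>\<^bsub>E\<^esub> x)) w \<le> f w)"
      by eventually_elim auto
  qed
  then show ?thesis using xy by (simp add: c_ball_def mod.M.minus_closed)
qed

section \<open>Comparison of the two closures\<close>

lemma locally_L0_convex_closure_subset:
  assumes G: "G \<subseteq> carrier E"
  shows "locally_L0_convex_topology M E N closure_of G
    \<subseteq> epsilon_lambda_topology M E N closure_of G"
proof
  fix x assume x: "x \<in> locally_L0_convex_topology M E N closure_of G"
  show "x \<in> epsilon_lambda_topology M E N closure_of G"
    unfolding in_epsilon_lambda_closure[OF G]
  proof (intro conjI allI impI)
    show "x \<in> carrier E" using x by (simp add: in_locally_L0_convex_closure[OF G])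
    fix Q and e l :: real assume Q: "admissible Q" and "0 < e" "0 < l"
    \<comment> \<open>A real constant is a legitimate random tolerance. Half of \<open>e\<close> is
      taken because \<open>c_ball\<close> gives only a weak inequality, whereas
      \<open>el_ball\<close> asks for a strict one.\<close>
    obtain y where y: "y \<in> G" "y \<ominus>\<^bsub>E\<^esub> x \<in> c_ball Q (\<lambda>_. e / 2)"
      using locally_L0_convex_closureE[OF G x Q, of "\<lambda>_. e / 2"] \<open>0 < e\<close> by auto
    have car: "y \<ominus>\<^bsub>E\<^esub> x \<in> carrier E" using y by (simp add: c_ball_def)
    have "AE w in M. \<forall>p\<in>Q. L0_rep (p (y \<ominus>\<^bsub>E\<^esub> x)) w \<le> e / 2"
      using y by (simp add: c_ball_def)
    then have "AE w in M. w \<in> {w \<in> space M. \<forall>p\<in>Q. L0_rep (p (y \<ominus>\<^bsub>E\<^esub> x)) w < e}"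
      using AE_space by eventually_elim (use \<open>0 < e\<close> in fastforce)
    then have "prob {w \<in> space M. \<forall>p\<in>Q. L0_rep (p (y \<ominus>\<^bsub>E\<^esub> x)) w < e} = 1"
      by (intro prob_eq_1[THEN iffD2] events_less[OF Q car])
    then show "\<exists>y\<in>G. y \<ominus>\<^bsub>E\<^esub> x \<in> el_ball Q e l"
      using y(1) car \<open>0 < l\<close> by (intro bexI[of _ y]) (auto simp: el_ball_def)
  qed
qed

text \<open>No single approximant need be within \<open>f\<close> of \<open>x\<close> almost
  everywhere, but each is so on a large event. Concatenation selects for almost every point an
  approximant that is good there.\<close>

lemma epsilon_lambda_closure_subset:
  assumes G: "G \<subseteq> carrier E" and ccp: "countable_concatenation_property M E G"
  shows "epsilon_lambda_topology M E N closure_of G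
    \<subseteq> locally_L0_convex_topology M E N closure_of G"
proof
  fix x assume x: "x \<in> epsilon_lambda_topology M E N closure_of G"
  have xE: "x \<in> carrier E" using x by (simp add: in_epsilon_lambda_closure[OF G])
  have "\<exists>y\<in>G. y \<ominus>\<^bsub>E\<^esub> x \<in> c_ball Q f"
    if Q: "admissible Q" and f [measurable]: "f \<in> borel_measurable M" and pos: "AE w in M. 0 < f w" for Q f
  proof -
    let ?B = "\<lambda>y. {w \<in> space M. \<forall>p\<in>Q. L0_rep (p (y \<ominus>\<^bsub>E\<^esub> x)) w \<le> f w}"
    have B_events: "?B y \<in> events" if "y \<in> G" for y
      using that G xE by (intro events_le Q f) (auto simp: mod.M.minus_closed)
    \<comment> \<open>One half of \<open>l\<close> pays for the event where \<open>f\<close> may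
      drop to the constant \<open>e\<close> or below, the other half for the event where
      \<open>y\<close> is not within \<open>e\<close> of \<open>x\<close>.\<close>
    have "\<exists>y\<in>G. 1 - l < prob (?B y)" if "0 < l" "l < 1" for l
    proof -
      obtain e where e: "0 < e" "1 - l / 2 < prob {w \<in> space M. e < f w}"
        using prob_above_constant[OF f pos, of "l / 2"] \<open>0 < l\<close> by auto
      obtain y where y: "y \<in> G" "y \<ominus>\<^bsub>E\<^esub> x \<in> el_ball Q e (l / 2)"
        using epsilon_lambda_closureE[OF G x Q e(1), of "l / 2"] \<open>0 < l\<close> \<open>l < 1\<close> by auto
      let ?S = "{w \<in> space M. \<forall>p\<in>Q. L0_rep (p (y \<ominus>\<^bsub>E\<^esub> x)) w < e}"
      have "?S \<in> events" using y by (intro events_less[OF Q]) (simp add: el_ball_def)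
      then have "1 - (l / 2 + l / 2) < prob (?S \<inter> {w \<in> space M. e < f w})"
        using y(2) e(2) by (intro prob_Int_gt) (auto simp: el_ball_def)
      also have "\<dots> \<le> prob (?B y)"
        by (intro finite_measure_mono B_events y(1)) force
      finally show ?thesis using y(1) by auto
    qed
    from this[of "1 / real (n + 2)" for n]
    have "\<forall>n. \<exists>y. y \<in> G \<and> 1 - 1 / real (n + 2) < prob (?B y)"
      by auto
    from choice[OF this]
    obtain Y where Y: "\<And>n. Y n \<in> G" "\<And>n. 1 - 1 / real (n + 2) < prob (?B (Y n))"
      by blast
    define U where "U = (\<Union>n. ?B (Y n))"
    have U: "U \<in> events" unfolding U_def using B_events Y(1) by auto
    have "prob U = 1"
    proof (rule antisym)
      have "(\<lambda>n. 1 - 1 / real (n + 2)) \<longlonglongrightarrow> 1" by real_asymp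
      moreover have "1 - 1 / real (n + 2) \<le> prob U" for n
      proof -
        have "prob (?B (Y n)) \<le> prob U"
          by (intro finite_measure_mono U) (auto simp: U_def)
        then show ?thesis using Y(2)[of n] by linarith
      qed
      ultimately show "1 \<le> prob U" by (intro LIMSEQ_le_const2) auto
    qed simp
    then have AE_U: "AE w in M. w \<in> U" using U by (simp add: prob_eq_1)
    \<comment> \<open>A partition must cover all of \<open>space M\<close>, while \<open>U\<close>
      may miss a null set. Adding the complement of \<open>U\<close> to every \<open>C n\<close>
      repairs this, and \<open>AE_U\<close> discards the added points in the estimate. Passing to
      \<open>disjointed C\<close> assigns each point to the first set containing it.\<close>
    define C where "C n = ?B (Y n) \<union> (space M - U)" for n
    have "range C \<subseteq> events" "(\<Union>n. C n) = space M"
      using B_events Y(1) U by (auto simp: C_def U_def)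
    then have A: "countable_partition M (disjointed C)" by (rule countable_partition_disjointed)
    obtain y where y: "y \<in> G" "is_concatenation M E (disjointed C) Y y"
      using ccp A Y(1) unfolding countable_concatenation_property_def by blast
    have "y \<ominus>\<^bsub>E\<^esub> x \<in> c_ball Q f"
    proof (rule concatenation_diff_in_c_ball[OF Q A _ _ concatenation_const[OF xE] y(2)])
      fix n
      show "AE w in M. w \<in> disjointed C n \<longrightarrow> (\<forall>p\<in>Q. L0_rep (p (Y n \<ominus>\<^bsub>E\<^esub> x)) w \<le> f w)"
        using AE_U by eventually_elim (use disjointed_subset[of C n] in \<open>auto simp: C_def\<close>)
    qed (use xE G Y(1) in auto)
    then show ?thesis using y(1) by blast
  qed
  then show "x \<in> locally_L0_convex_topology M E N closure_of G"
    using xE by (simp add: in_locally_L0_convex_closure[OF G])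
qed

text \<open>The property of \<open>E\<close> supplies the candidate \<open>x\<close>. For a given
  ball, each \<open>X n\<close> has an approximant in \<open>G\<close> with the same
  \<open>Q\<close> and \<open>f\<close>, and concatenating these along the same partition
  approximates \<open>x\<close> without loss.\<close>

lemma closure_countable_concatenation:
  assumes G: "G \<subseteq> carrier E" and ccp: "countable_concatenation_property M E G"
    and ccE: "countable_concatenation_property M E (carrier E)"
  shows "countable_concatenation_property M E (locally_L0_convex_topology M E N closure_of G)"
  unfolding countable_concatenation_property_def
proof (intro allI impI, elim conjE)
  fix X :: "nat \<Rightarrow> 'e" and A :: "nat \<Rightarrow> 'w set"
  assume X: "range X \<subseteq> locally_L0_convex_topology M E N closure_of G"
    and A: "countable_partition M A"
  have XE: "range X \<subseteq> carrier E"
    using X in_locally_L0_convex_closure[OF G] by auto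
  obtain x where x: "x \<in> carrier E" "is_concatenation M E A X x"
    using ccE XE A unfolding countable_concatenation_property_def by blast
  have "\<exists>y\<in>G. y \<ominus>\<^bsub>E\<^esub> x \<in> c_ball Q f"
    if Q: "admissible Q" and f: "f \<in> borel_measurable M" "AE w in M. 0 < f w" for Q f
  proof -
    have "\<exists>y\<in>G. y \<ominus>\<^bsub>E\<^esub> X n \<in> c_ball Q f" for n
      using X locally_L0_convex_closureE[OF G _ Q f, of "X n"] by blast
    then obtain Y where Y: "\<And>n. Y n \<in> G" "\<And>n. Y n \<ominus>\<^bsub>E\<^esub> X n \<in> c_ball Q f" by metis
    then obtain y where y: "y \<in> G" "is_concatenation M E A Y y"
      using ccp A unfolding countable_concatenation_property_def by blast
    have "y \<ominus>\<^bsub>E\<^esub> x \<in> c_ball Q f"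
    proof (rule concatenation_diff_in_c_ball[OF Q A XE _ x(2) y(2)])
      show "range Y \<subseteq> carrier E" using Y(1) G by auto
      fix n
      show "AE w in M. w \<in> A n \<longrightarrow> (\<forall>p\<in>Q. L0_rep (p (Y n \<ominus>\<^bsub>E\<^esub> X n)) w \<le> f w)"
        using Y(2)[of n] by (auto simp: c_ball_def)
    qed
    then show ?thesis using y(1) by blast
  qed
  then have "x \<in> locally_L0_convex_topology M E N closure_of G"
    using x(1) by (simp add: in_locally_L0_convex_closure[OF G])
  then show "\<exists>x\<in>locally_L0_convex_topology M E N closure_of G. is_concatenation M E A X x"
    using x(2) by blast
qed


subsection \<open>The countable concatenation hull\<close>

lemma hull_subset_carrier: "countable_concatenation_hull M E G \<subseteq> carrier E"
  by (auto simp: countable_concatenation_hull_def is_concatenation_def)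

lemma subset_hull:
  assumes "G \<subseteq> carrier E"
  shows "G \<subseteq> countable_concatenation_hull M E G"
proof
  fix x assume x: "x \<in> G"
  \<comment> \<open>The trivial partition, padded with empty sets, exhibits \<open>x\<close> as a
    concatenation of the constant sequence.\<close>
  have "countable_partition M (\<lambda>n. if n = 0 then space M else {})"
    by (auto simp: countable_partition_def disjoint_family_on_def)
  then show "x \<in> countable_concatenation_hull M E G"
    unfolding countable_concatenation_hull_def
    using x assms concatenation_const[of x]
    by (intro CollectI exI[of _ "\<lambda>_. x"] exI conjI) auto
qed

lemma ind_smult_smult:
  assumes "A \<in> events" "B \<in> events" "x \<in> carrier E"
  shows "ind A \<odot>\<^bsub>E\<^esub> (ind B \<odot>\<^bsub>E\<^esub> x) = ind (A \<inter> B) \<odot>\<^bsub>E\<^esub> x"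
  using assms
  by (simp add: L0_ind_mult[symmetric] ind_in_carrier mod.smult_assoc1)

text \<open>A concatenation of concatenations is again one, along the common refinement by the sets
  \<open>A n \<inter> B n m\<close>. The pairs \<open>(n, m)\<close> are enumerated by
  \<open>prod_decode\<close> to obtain a single sequence.\<close>

lemma hull_countable_concatenation:
  assumes G: "G \<subseteq> carrier E" and ccE: "countable_concatenation_property M E (carrier E)"
  shows "countable_concatenation_property M E (countable_concatenation_hull M E G)"
  unfolding countable_concatenation_property_def
proof (intro allI impI, elim conjE)
  fix X :: "nat \<Rightarrow> 'e" and A :: "nat \<Rightarrow> 'w set"
  assume X: "range X \<subseteq> countable_concatenation_hull M E G"
    and A: "countable_partition M A"
  obtain x where x: "x \<in> carrier E" "is_concatenation M E A X x"
    using ccE A X hull_subset_carrier unfolding countable_concatenation_property_def by blast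
  have "\<forall>n. \<exists>Y B. range Y \<subseteq> G \<and> countable_partition M B \<and> is_concatenation M E B Y (X n)"
    using X unfolding countable_concatenation_hull_def by blast
  then obtain Y B where Y: "\<And>n. range (Y n) \<subseteq> G" "\<And>n. countable_partition M (B n)"
    "\<And>n. is_concatenation M E (B n) (Y n) (X n)" by metis
  define Z where "Z k = (case prod_decode k of (n, m) \<Rightarrow> Y n m)" for k
  define C where "C k = (case prod_decode k of (n, m) \<Rightarrow> A n \<inter> B n m)" for k
  have ev: "A n \<in> events" "B n m \<in> events" for n m
    using A Y(2)[of n] by (auto simp: countable_partition_def)
  have "countable_partition M C"
    unfolding countable_partition_def
  proof (intro conjI)
    show "range C \<subseteq> events" using ev by (auto simp: C_def split: prod.split)
    show "disjoint_family C"
      unfolding disjoint_family_on_def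
    proof (intro ballI impI)
      fix j k :: nat
      assume "j \<noteq> k"
      obtain n m n' m' where d: "prod_decode j = (n, m)" "prod_decode k = (n', m')"
        by (metis prod.exhaust)
      have "(n, m) \<noteq> (n', m')" using d \<open>j \<noteq> k\<close> by (metis prod_decode_inverse)
      moreover have "A n \<inter> A n' = {}" if "n \<noteq> n'"
        using A that by (auto simp: countable_partition_def disjoint_family_on_def)
      moreover have "B n m \<inter> B n m' = {}" if "m \<noteq> m'"
        using Y(2)[of n] that by (auto simp: countable_partition_def disjoint_family_on_def)
      ultimately show "C j \<inter> C k = {}"
        by (cases "n = n'") (auto simp: C_def d)
    qed
    show "(\<Union>k. C k) = space M"
    proof (intro subset_antisym subsetI)
      fix w assume "w \<in> space M"
      then obtain n where n: "w \<in> A n" using A by (auto simp: countable_partition_def)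
      obtain m where "w \<in> B n m" using Y(2)[of n] \<open>w \<in> space M\<close> by (auto simp: countable_partition_def)
      then have "w \<in> C (prod_encode (n, m))" using n by (simp add: C_def)
      then show "w \<in> (\<Union>k. C k)" by blast
    qed (use \<open>range C \<subseteq> events\<close> sets.sets_into_space in blast)
  qed
  moreover have "is_concatenation M E C Z x"
    unfolding is_concatenation_def
  proof (intro conjI allI)
    fix k
    obtain n m where k: "prod_decode k = (n, m)" by (cases "prod_decode k")
    have car: "X n \<in> carrier E" "Y n m \<in> carrier E"
      using X hull_subset_carrier Y(1)[of n] G by blast+
    \<comment> \<open>The indicators commute: with \<open>ind (A n)\<close> innermost
      \<open>x\<close> turns into \<open>X n\<close>, and with \<open>ind (B n m)\<close> innermost
      \<open>X n\<close> turns into \<open>Y n m\<close>.\<close>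
    have "ind (A n \<inter> B n m) \<odot>\<^bsub>E\<^esub> x = ind (B n m) \<odot>\<^bsub>E\<^esub> (ind (A n) \<odot>\<^bsub>E\<^esub> x)"
      using ev x(1) by (simp add: ind_smult_smult Int_commute)
    also have "\<dots> = ind (B n m) \<odot>\<^bsub>E\<^esub> (ind (A n) \<odot>\<^bsub>E\<^esub> X n)"
      using x(2) by (simp add: is_concatenation_def)
    also have "\<dots> = ind (A n) \<odot>\<^bsub>E\<^esub> (ind (B n m) \<odot>\<^bsub>E\<^esub> X n)"
      using ev car by (simp add: ind_smult_smult Int_commute)
    also have "\<dots> = ind (A n) \<odot>\<^bsub>E\<^esub> (ind (B n m) \<odot>\<^bsub>E\<^esub> Y n m)"
      using Y(3)[of n] by (simp add: is_concatenation_def)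
    also have "\<dots> = ind (A n \<inter> B n m) \<odot>\<^bsub>E\<^esub> Y n m"
      using ev car by (simp add: ind_smult_smult)
    finally show "ind (C k) \<odot>\<^bsub>E\<^esub> x = ind (C k) \<odot>\<^bsub>E\<^esub> Z k"
      by (simp add: C_def Z_def k)
  qed (rule x(1))
  moreover have "range Z \<subseteq> G" using Y(1) by (fastforce simp: Z_def split: prod.split)
  ultimately have "x \<in> countable_concatenation_hull M E G"
    unfolding countable_concatenation_hull_def by blast
  then show "\<exists>x\<in>countable_concatenation_hull M E G. is_concatenation M E A X x"
    using x(2) by blast
qed

section \<open>Finite concatenations in \<open>L0\<close>-convex sets\<close>

lemma ind_convex_combination:
  assumes A: "A \<in> events" "B \<in> events" and x: "x \<in> carrier E" "y \<in> carrier E"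
  shows "ind A \<odot>\<^bsub>E\<^esub> (ind B \<odot>\<^bsub>E\<^esub> x \<oplus>\<^bsub>E\<^esub> (\<one>\<^bsub>L0_ring M\<^esub> \<ominus>\<^bsub>L0_ring M\<^esub> ind B) \<odot>\<^bsub>E\<^esub> y)
    = ind (A \<inter> B) \<odot>\<^bsub>E\<^esub> x \<oplus>\<^bsub>E\<^esub> (ind A \<odot>\<^bsub>E\<^esub> y \<ominus>\<^bsub>E\<^esub> ind (A \<inter> B) \<odot>\<^bsub>E\<^esub> y)"
proof -
  note c = A[THEN ind_in_carrier]
  have "(\<one>\<^bsub>L0_ring M\<^esub> \<ominus>\<^bsub>L0_ring M\<^esub> ind B) \<odot>\<^bsub>E\<^esub> y = y \<ominus>\<^bsub>E\<^esub> ind B \<odot>\<^bsub>E\<^esub> y"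
    using c x by (simp add: mod.R.minus_eq mod.M.minus_eq mod.smult_l_distr mod.smult_l_minus)
  then show ?thesis
    using c x A
    by (simp add: mod.M.minus_eq mod.smult_r_distr mod.smult_r_minus ind_smult_smult)
qed

text \<open>By induction on the number of pieces: the convex combination with coefficient
  \<open>ind (A k)\<close> overwrites the current element by \<open>X k\<close> on
  \<open>A k\<close> and, by disjointness, leaves the earlier pieces intact. Nothing is claimed
  outside the first \<open>k\<close> sets.\<close>

lemma L0_convex_finite_concatenation:
  fixes A :: "nat \<Rightarrow> 'w set"
  assumes conv: "L0_convex M E G" and G: "G \<subseteq> carrier E"
    and X: "range X \<subseteq> G" and A: "disjoint_family A" "range A \<subseteq> events"
  shows "\<exists>z\<in>G. \<forall>n<k. ind (A n) \<odot>\<^bsub>E\<^esub> z = ind (A n) \<odot>\<^bsub>E\<^esub> X n"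
proof (induction k)
  case 0
  \<comment> \<open>No piece has to be matched yet, so any member of the sequence witnesses the
    claim.\<close>
  then show ?case using X by auto
next
  case (Suc k)
  then obtain z where z: "z \<in> G" "\<And>n. n < k \<Longrightarrow> ind (A n) \<odot>\<^bsub>E\<^esub> z = ind (A n) \<odot>\<^bsub>E\<^esub> X n" by auto
  let ?z = "ind (A k) \<odot>\<^bsub>E\<^esub> X k \<oplus>\<^bsub>E\<^esub> (\<one>\<^bsub>L0_ring M\<^esub> \<ominus>\<^bsub>L0_ring M\<^esub> ind (A k)) \<odot>\<^bsub>E\<^esub> z"
  have ev: "A n \<in> events" for n using A(2) by auto
  have car: "X n \<in> carrier E" "z \<in> carrier E" for n using X z(1) G by auto
  have "X k \<in> G" using X by auto
  then have "?z \<in> G"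
    using conv z(1) L0_ind_nonneg_le_one[OF ev[of k]] L0_of_real_ind[OF ev[of k], where 'k = 'k]
    unfolding L0_convex_def by metis
  moreover have "ind (A n) \<odot>\<^bsub>E\<^esub> ?z = ind (A n) \<odot>\<^bsub>E\<^esub> X n" if "n < Suc k" for n
  proof (cases "n = k")
    case True
    then show ?thesis
      using car ind_in_carrier[OF ev[of k]]
      by (simp add: ind_convex_combination ev mod.M.minus_eq mod.M.r_neg)
  next
    case False
    then have "A n \<inter> A k = {}" using A(1) by (auto simp: disjoint_family_on_def)
    then show ?thesis
      using car z(2)[of n] ind_in_carrier[OF ev[of n]] False that
      by (simp add: ind_convex_combination ev L0_ind_empty mod.M.minus_eq)
  qed
  ultimately show ?case by blast
qed

text \<open>A finite concatenation agrees with \<open>h\<close> on the first \<open>k\<close>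
  pieces, whose union has probability above \<open>1 - l\<close> for a suitable \<open>k\<close>.
  There the difference has seminorm zero, so it is below every \<open>e\<close>.\<close>

lemma hull_subset_epsilon_lambda_closure:
  assumes conv: "L0_convex M E G" and G: "G \<subseteq> carrier E"
  shows "countable_concatenation_hull M E G \<subseteq> epsilon_lambda_topology M E N closure_of G"
proof
  fix h assume "h \<in> countable_concatenation_hull M E G"
  then obtain X A where X: "range X \<subseteq> G" and A: "countable_partition M A"
    and h: "is_concatenation M E A X h"
    by (auto simp: countable_concatenation_hull_def)
  have hE: "h \<in> carrier E" using h by (simp add: is_concatenation_def)
  have ev: "range A \<subseteq> events" using A by (simp add: countable_partition_def)
  show "h \<in> epsilon_lambda_topology M E N closure_of G"
    unfolding in_epsilon_lambda_closure[OF G]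
  proof (intro conjI allI impI)
    fix Q and e l :: real assume Q: "admissible Q" and "0 < e" "0 < l"
    let ?U = "\<lambda>k. \<Union>n<k. A n"
    have "(\<Union>k. ?U k) = (\<Union>n. A n)" by auto
    then have "(\<Union>k. ?U k) = space M" using A by (simp only: countable_partition_def)
    moreover have "range ?U \<subseteq> events" using ev by auto
    moreover have "incseq ?U" by (rule incseq_SucI) (auto simp: less_Suc_eq)
    ultimately obtain k where k: "1 - l < prob (?U k)"
      using prob_incseq_gt[of ?U l] \<open>0 < l\<close> prob_space by metis
    obtain z where z: "z \<in> G" "\<And>n. n < k \<Longrightarrow> ind (A n) \<odot>\<^bsub>E\<^esub> z = ind (A n) \<odot>\<^bsub>E\<^esub> X n"
      using L0_convex_finite_concatenation[OF conv G X _ ev, of k] A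
      by (auto simp: countable_partition_def)
    have zE: "z \<in> carrier E" using z(1) G by auto
    have "AE w in M. w \<in> A n \<longrightarrow> L0_rep (p (z \<ominus>\<^bsub>E\<^esub> h)) w = L0_rep (p \<zero>\<^bsub>E\<^esub>) w"
      if "p \<in> Q" "n < k" for p n
    proof -
      \<comment> \<open>Over \<open>A n\<close> both \<open>z\<close> and \<open>h\<close> coincide
        with \<open>X n\<close>, so locality replaces \<open>z - h\<close> by
        \<open>h - h\<close>.\<close>
      have "AE w in M. w \<in> A n \<longrightarrow> L0_rep (p (z \<ominus>\<^bsub>E\<^esub> h)) w = L0_rep (p (h \<ominus>\<^bsub>E\<^esub> h)) w"
        by (rule seminorm_local)
          (use that Q ev z(2) hE zE h in \<open>auto simp: admissible_def is_concatenation_def\<close>)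
      then show ?thesis using hE by (simp add: mod.M.minus_eq mod.M.r_neg)
    qed
    then have "AE w in M. \<forall>p\<in>Q. \<forall>n\<in>{..<k}. w \<in> A n \<longrightarrow>
        L0_rep (p (z \<ominus>\<^bsub>E\<^esub> h)) w = L0_rep (p \<zero>\<^bsub>E\<^esub>) w"
      using Q by (intro AE_finite_allI) (auto simp: admissible_def)
    with seminorms_zero[OF Q] AE_space
    have "AE w in M. w \<in> ?U k \<longrightarrow> w \<in> {w \<in> space M. \<forall>p\<in>Q. L0_rep (p (z \<ominus>\<^bsub>E\<^esub> h)) w < e}"
      by eventually_elim (use \<open>0 < e\<close> in auto)
    then have "prob (?U k) \<le> prob {w \<in> space M. \<forall>p\<in>Q. L0_rep (p (z \<ominus>\<^bsub>E\<^esub> h)) w < e}"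
      using hE zE by (intro finite_measure_mono_AE events_less[OF Q]) (auto simp: mod.M.minus_closed)
    then show "\<exists>y\<in>G. y \<ominus>\<^bsub>E\<^esub> h \<in> el_ball Q e l"
      using k z(1) hE zE by (intro bexI[of _ z]) (auto simp: el_ball_def mod.M.minus_closed)
  qed (rule hE)
qed

end

section \<open>Combining the inclusions for \<open>G\<close> and for its hull\<close>

theorem theorem2p28:
  fixes M :: "'w measure"
    and E :: "(('w \<Rightarrow> 'k::{real_normed_field, euclidean_space}) set, 'e) module"
    and N :: "('e \<Rightarrow> ('w \<Rightarrow> real) set) set"
    and G :: "'e set"
  assumes "random_lc_module M E N"
    and "countable_concatenation_property M E (carrier E)"
    and "G \<subseteq> carrier E"
  shows "(countable_concatenation_property M E G \<longrightarrow>
      locally_L0_convex_topology M E N closure_of G = epsilon_lambda_topology M E N closure_of G \<and>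
      countable_concatenation_property M E (locally_L0_convex_topology M E N closure_of G)) \<and>
    (L0_convex M E G \<longrightarrow>
      epsilon_lambda_topology M E N closure_of G =
        epsilon_lambda_topology M E N closure_of (countable_concatenation_hull M E G) \<and>
      epsilon_lambda_topology M E N closure_of (countable_concatenation_hull M E G) =
        locally_L0_convex_topology M E N closure_of (countable_concatenation_hull M E G) \<and>
      countable_concatenation_property M E (epsilon_lambda_topology M E N closure_of G))"
proof -
  interpret random_lc M E N by unfold_locales (rule assms(1))
  let ?el = "epsilon_lambda_topology M E N" and ?c = "locally_L0_convex_topology M E N"
  let ?H = "countable_concatenation_hull M E G"
  \<comment> \<open>The first part is proved for an arbitrary \<open>S\<close> with the
    concatenation property, since it is applied both to \<open>G\<close> and to the hull.\<close>
  have closures: "?c closure_of S = ?el closure_of S"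
    and ccp: "countable_concatenation_property M E (?c closure_of S)"
    if "S \<subseteq> carrier E" "countable_concatenation_property M E S" for S
    using locally_L0_convex_closure_subset epsilon_lambda_closure_subset
      closure_countable_concatenation that assms(2) by blast+
  note H = hull_subset_carrier[of G] hull_countable_concatenation[OF assms(3,2)]
  have "?el closure_of G = ?el closure_of ?H" if "L0_convex M E G"
  proof
    show "?el closure_of G \<subseteq> ?el closure_of ?H"
      by (rule closure_of_mono[OF subset_hull[OF assms(3)]])
    \<comment> \<open>The closure of \<open>G\<close> is closed and, by convexity, already contains
      the hull; hence it contains the closure of the hull.\<close>
    show "?el closure_of ?H \<subseteq> ?el closure_of G"
      by (rule closure_of_minimal[OF hull_subset_epsilon_lambda_closure[OF that assms(3)]
            closedin_closure_of])
  qed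
  then show ?thesis
    using closures[OF assms(3)] ccp[OF assms(3)] closures[OF H] ccp[OF H] by simp
qed

end
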